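(* Let $p$ and $q$ be any positive integers, let $\alpha\in[0,1]$, and let $c\ge0$, $\tau\ge0$, $\beta\ge0$. Let $(u_h,v_h)$, with $u_h(\cdot,t)\in V_h^p(\Omega)$ and $v_h(\cdot,t)\in V_h^q(\Omega)$, be a solution of the two-dimensional semi-discrete OF-EDG scheme described in the context, on a rectangular domain $\Omega\subset\mathbb{R}^2$ with periodic boundary conditions in each direction and with numerical fluxes $\widehat v,\widehat{\nabla u}$ given by the parameters $\alpha,\tau,\beta$. Then the semi-discrete energy $$\mathbb{E}_h(t)=\int_\Omega\big(\nabla u_h\cdot\nabla u_h+v_h^2\big)\,d\mathbf{x}$$ (with $\nabla u_h$ taken element by element) satisfies $$\frac{d\,\mathbb{E}_h}{dt}\le0.$$
   Context: The scheme discretizes $u_{tt}=\Delta u$ on $\Omega\times(0,T]$, written as $u_t=v$, $v_t=\Delta u$, on a rectangle $\Omega$ with periodic boundary conditions in each direction. Mesh: $\Omega$ is partitioned into the rectangles $K_{ij}=[x_{i-1/2},x_{i+1/2}]\times[y_{j-1/2},y_{j+1/2}]$, $i=1,\dots,N_x$, $j=1,\dots,N_y$; $h^x_i=x_{i+1/2}-x_{i-1/2}$, $h^y_j=y_{j+1/2}-y_{j-1/2}$, $h_{ij}=\sqrt{(h^x_i)^2+(h^y_j)^2}$, $h=\max h_{ij}$. $V_h^k(\Omega)=\{w\in L^2(\Omega):w|_{K_{ij}}\in P^k(K_{ij})\ \forall i,j\}$, where $P^k(K_{ij})$ is the space of polynomials of degree at most $k$ on $K_{ij}$. Derivatives of functions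 in $V_h^k(\Omega)$ are taken element by element. Opposite sides of $\Omega$ are identified (periodicity), so that every element edge is shared by two elements. On $\partial K_{ij}$, $\mathbf{n}$ is the outward unit normal of $K_{ij}$; superscripts $-$ and $+$ denote traces from inside and outside $K_{ij}$; $\mathbf{n}^-=\mathbf{n}$, $\mathbf{n}^+=-\mathbf{n}$. Jumps: $[\![w]\!]=w^+\mathbf{n}^++w^-\mathbf{n}^-\in\mathbb{R}^2$ and $[\![\nabla w]\!]=\nabla w^+\cdot\mathbf{n}^++\nabla w^-\cdot\mathbf{n}^-\in\mathbb{R}$. Numerical fluxes, with $\boldsymbol\zeta=(\alpha-\tfrac12,\alpha-\tfrac12)^T$: $$\widehat{\nabla u}=\frac{\nabla u_h^++\nabla u_h^-}{2}-\big((\boldsymbol\zeta\cdot\mathbf{n}^+)\nabla u_h^++(\boldsymbol\zeta\cdot\mathbf{n}^-)\nabla u_h^-\big)-\beta[\![v_h]\!],$$ $$\widehat v=\frac{v_h^++v_h^-}{2}+\boldsymbol\zeta\cdot(v_h^+\mathbf{n}^++v_h^-\mathbf{n}^-)-\tau[\![\nabla u_h]\!].$$ $\mathbb{P}^l$ ($l\ge0$) is the $L^2$ projection onto $V_h^l(\Omega)$: $\int_{K_{ij}}(\mathbb{P}^lw-w)\phi\,d\mathbf{x}=0$ for all $\phi\in P^l(K_{ij})$ and all $i,j$ (applied componentwise to vector fields); by convention $\mathbb{P}^{-1}=\mathbb{P}^0$. Damping coefficients: for a vertex $\mathbf{v}$ of $K_{ij}$, $[\![w]\!]|_{\mathbf{v}}^2$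 denotes the sum, over the two elements $K'$ that share with $K_{ij}$ an edge containing $\mathbf{v}$, of $(w|_{K_{ij}}(\mathbf{v})-w|_{K'}(\mathbf{v}))^2$. With multi-indices $\boldsymbol\alpha=(\alpha_1,\alpha_2)$, $|\boldsymbol\alpha|=\alpha_1+\alpha_2$, $\partial^{\boldsymbol\alpha}w=\partial^{|\boldsymbol\alpha|}w/\partial x^{\alpha_1}\partial y^{\alpha_2}$, and sums over the four vertices $\mathbf{v}$ of $K_{ij}$: $$\sigma_{ij}^l=\frac{2(2l+1)}{2p-1}\frac{h_{ij}^l}{l!}\sum_{|\boldsymbol\alpha|=l}\Big(\frac14\sum_{\mathbf{v}\in K_{ij}}[\![\partial^{\boldsymbol\alpha}u_h]\!]|_{\mathbf{v}}^2\Big)^{1/2}\ (l\ge1),$$ $$\tilde\sigma_{ij}^l=\frac{2(2l+1)}{2q-1}\frac{h_{ij}^{l+1}}{(l+1)!}\sum_{|\boldsymbol\alpha|=l}\Big(\frac14\sum_{\mathbf{v}\in K_{ij}}[\![\partial^{\boldsymbol\alpha}v_h]\!]|_{\mathbf{v}}^2\Big)^{1/2}\ (l\ge0).$$ OF-EDG scheme: $u_h(\cdot,t)\in V_h^p(\Omega)$ and $v_h(\cdot,t)\in V_h^q(\Omega)$ (differentiable in $t$) satisfy, for every element $K_{ij}$, all $\phi^{(u)}\in V_h^p(\Omega)$, all $\phi^{(v)}\in V_h^q(\Omega)$ and all times $t$: $$\int_{K_{ij}}\big((u_h)_t-v_h\big)d\mathbf{x}=0,$$ $$\begin{aligned}\int_{K_{ij}}\nabla\big((u_h)_t-v_h\big)\cdot\nabla\phi^{(u)}d\mathbf{x}=&\int_{\partial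 K_{ij}}(\widehat v-v_h^-)(\nabla\phi^{(u),-}\cdot\mathbf{n})\,dS-\frac{c}{h^2}\int_{\partial K_{ij}}([\![u_h]\!]\cdot\mathbf{n})\phi^{(u),-}dS\\&-\sum_{l=1}^p\frac{\sigma_{ij}^l}{h_{ij}}\int_{K_{ij}}(\nabla u_h-\mathbb{P}^{l-1}\nabla u_h)\cdot\nabla\phi^{(u)}d\mathbf{x},\end{aligned}$$ $$\int_{K_{ij}}\big((v_h)_t\phi^{(v)}+\nabla u_h\cdot\nabla\phi^{(v)}\big)d\mathbf{x}=\int_{\partial K_{ij}}(\widehat{\nabla u}\cdot\mathbf{n})\phi^{(v),-}dS-\sum_{l=0}^q\frac{\tilde\sigma_{ij}^l}{h_{ij}}\int_{K_{ij}}(v_h-\mathbb{P}^{l-1}v_h)\phi^{(v)}d\mathbf{x}.$$ *)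

theory Defs
  imports "HOL-Analysis.Analysis"
begin

subsection \<open>Periodic tensor-product mesh\<close>

text \<open>
  The field \<open>gx M i\<close> is the grid coordinate \<open>x_{i+1/2}\<close> for \<open>i = 0, ..., nx M\<close>, likewise
  \<open>gy M j\<close> is \<open>y_{j+1/2}\<close>. Elements are the pairs \<open>(i, j)\<close> with \<open>1 \<le> i \<le> nx M\<close> and
  \<open>1 \<le> j \<le> ny M\<close>.
\<close>

record mesh =
  nx :: nat
  ny :: nat
  gx :: "nat \<Rightarrow> real"
  gy :: "nat \<Rightarrow> real"

definition valid_mesh :: "mesh \<Rightarrow> bool" where
  "valid_mesh M \<longleftrightarrow> 1 \<le> nx M \<and> 1 \<le> ny M \<and>
     (\<forall>i<nx M. gx M i < gx M (Suc i)) \<and> (\<forall>j<ny M. gy M j < gy M (Suc j))"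

definition domain_rect :: "mesh \<Rightarrow> (real \<times> real) set" where
  "domain_rect M = cbox (gx M 0, gy M 0) (gx M (nx M), gy M (ny M))"

definition elements :: "mesh \<Rightarrow> (nat \<times> nat) set" where
  "elements M = {1..nx M} \<times> {1..ny M}"

fun rect :: "mesh \<Rightarrow> nat \<times> nat \<Rightarrow> (real \<times> real) set" where
  "rect M (i, j) = cbox (gx M (i - 1), gy M (j - 1)) (gx M i, gy M j)"

fun diam :: "mesh \<Rightarrow> nat \<times> nat \<Rightarrow> real" where
  "diam M (i, j) = sqrt ((gx M i - gx M (i - 1))\<^sup>2 + (gy M j - gy M (j - 1))\<^sup>2)"

definition mesh_size :: "mesh \<Rightarrow> real" where
  "mesh_size M = Max (diam M ` elements M)"

datatype side = West | East | South | North

fun opposite :: "side \<Rightarrow> side" where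
  "opposite West = East"
| "opposite East = West"
| "opposite South = North"
| "opposite North = South"

fun normal :: "side \<Rightarrow> real \<times> real" where
  "normal West = (-1, 0)"
| "normal East = (1, 0)"
| "normal South = (0, -1)"
| "normal North = (0, 1)"

fun neighbour :: "mesh \<Rightarrow> nat \<times> nat \<Rightarrow> side \<Rightarrow> nat \<times> nat" where
  "neighbour M (i, j) West = (if i = 1 then nx M else i - 1, j)"
| "neighbour M (i, j) East = (if i = nx M then 1 else i + 1, j)"
| "neighbour M (i, j) South = (i, if j = 1 then ny M else j - 1)"
| "neighbour M (i, j) North = (i, if j = ny M then 1 else j + 1)"

text \<open>
  A side is parametrised by arc length, through the coordinate that varies along it. A point on
  side \<open>s\<close> of an element and the point with the same parameter on side \<open>opposite s\<close> of the
  neighbour across \<open>s\<close> are equal, or identified by periodicity.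
\<close>

fun side_range :: "mesh \<Rightarrow> nat \<times> nat \<Rightarrow> side \<Rightarrow> real set" where
  "side_range M (i, j) West = {gy M (j - 1)..gy M j}"
| "side_range M (i, j) East = {gy M (j - 1)..gy M j}"
| "side_range M (i, j) South = {gx M (i - 1)..gx M i}"
| "side_range M (i, j) North = {gx M (i - 1)..gx M i}"

fun side_point :: "mesh \<Rightarrow> nat \<times> nat \<Rightarrow> side \<Rightarrow> real \<Rightarrow> real \<times> real" where
  "side_point M (i, j) West r = (gx M (i - 1), r)"
| "side_point M (i, j) East r = (gx M i, r)"
| "side_point M (i, j) South r = (r, gy M (j - 1))"
| "side_point M (i, j) North r = (r, gy M j)"

definition boundary_integral :: "mesh \<Rightarrow> nat \<times> nat \<Rightarrow> (side \<Rightarrow> real \<Rightarrow> real) \<Rightarrow> real" where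
  "boundary_integral M K f =
     (\<Sum>s\<in>{West, East, South, North}. integral (side_range M K s) (f s))"

subsection \<open>Piecewise polynomials, derivatives and traces\<close>

definition poly_space :: "nat \<Rightarrow> (real \<times> real \<Rightarrow> real) set" where
  "poly_space k = {f. \<exists>c. \<forall>x y. f (x, y) = (\<Sum>(a, b)\<in>{(a, b). a + b \<le> k}. c a b * x ^ a * y ^ b)}"

text \<open>
  The elements of \<open>V_h^k\<close> are \<open>L^2\<close> classes; a representative is prescribed on the open elements
  only, since adjacent polynomials need not agree on common edges. Its values on the mesh lines
  (a null set) are arbitrary and are never used: volume integrals ignore them, and everything on
  edges and at vertices is a trace, that is, a limit from the interior of an element. Square
  integrability is automatic.
\<close>

definition Vh :: "mesh \<Rightarrow> nat \<Rightarrow> (real \<times> real \<Rightarrow> real) set" where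
  "Vh M k = {w. \<forall>K\<in>elements M. \<exists>f\<in>poly_space k. \<forall>z\<in>interior (rect M K). w z = f z}"

text \<open>
  Pointwise partial derivatives. At points of open elements these are the element-by-element
  derivatives.
\<close>

definition dx :: "(real \<times> real \<Rightarrow> real) \<Rightarrow> real \<times> real \<Rightarrow> real" where
  "dx w z = deriv (\<lambda>s. w (s, snd z)) (fst z)"

definition dy :: "(real \<times> real \<Rightarrow> real) \<Rightarrow> real \<times> real \<Rightarrow> real" where
  "dy w z = deriv (\<lambda>s. w (fst z, s)) (snd z)"

definition grad :: "(real \<times> real \<Rightarrow> real) \<Rightarrow> real \<times> real \<Rightarrow> real \<times> real" where
  "grad w z = (dx w z, dy w z)"

definition partial_deriv :: "nat \<Rightarrow> nat \<Rightarrow> (real \<times> real \<Rightarrow> real) \<Rightarrow> real \<times> real \<Rightarrow> real" where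
  "partial_deriv a b w = (dx ^^ a) ((dy ^^ b) w)"

definition elem_trace :: "mesh \<Rightarrow> (real \<times> real \<Rightarrow> 'a::t2_space) \<Rightarrow> nat \<times> nat \<Rightarrow> real \<times> real \<Rightarrow> 'a" where
  "elem_trace M w K z = Lim (at z within interior (rect M K)) w"

definition trace_in :: "mesh \<Rightarrow> (real \<times> real \<Rightarrow> 'a::t2_space) \<Rightarrow> nat \<times> nat \<Rightarrow> side \<Rightarrow> real \<Rightarrow> 'a" where
  "trace_in M w K s r = elem_trace M w K (side_point M K s r)"

definition trace_out :: "mesh \<Rightarrow> (real \<times> real \<Rightarrow> 'a::t2_space) \<Rightarrow> nat \<times> nat \<Rightarrow> side \<Rightarrow> real \<Rightarrow> 'a" where
  "trace_out M w K s r = trace_in M w (neighbour M K s) (opposite s) r"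

definition jump :: "mesh \<Rightarrow> (real \<times> real \<Rightarrow> real) \<Rightarrow> nat \<times> nat \<Rightarrow> side \<Rightarrow> real \<Rightarrow> real \<times> real" where
  "jump M w K s r = trace_out M w K s r *\<^sub>R (- normal s) + trace_in M w K s r *\<^sub>R normal s"

definition grad_jump :: "mesh \<Rightarrow> (real \<times> real \<Rightarrow> real) \<Rightarrow> nat \<times> nat \<Rightarrow> side \<Rightarrow> real \<Rightarrow> real" where
  "grad_jump M w K s r =
     trace_out M (grad w) K s r \<bullet> (- normal s) + trace_in M (grad w) K s r \<bullet> normal s"

subsection \<open>Numerical fluxes\<close>

definition zeta :: "real \<Rightarrow> real \<times> real" where
  "zeta \<alpha> = (\<alpha> - 1/2, \<alpha> - 1/2)"

definition flux_grad ::
  "mesh \<Rightarrow> real \<Rightarrow> real \<Rightarrow> (real \<times> real \<Rightarrow> real) \<Rightarrow> (real \<times> real \<Rightarrow> real) \<Rightarrow>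
   nat \<times> nat \<Rightarrow> side \<Rightarrow> real \<Rightarrow> real \<times> real" where
  "flux_grad M \<alpha> \<beta> u v K s r =
     (1/2) *\<^sub>R (trace_out M (grad u) K s r + trace_in M (grad u) K s r)
     - ((zeta \<alpha> \<bullet> (- normal s)) *\<^sub>R trace_out M (grad u) K s r
        + (zeta \<alpha> \<bullet> normal s) *\<^sub>R trace_in M (grad u) K s r)
     - \<beta> *\<^sub>R jump M v K s r"

definition flux_v ::
  "mesh \<Rightarrow> real \<Rightarrow> real \<Rightarrow> (real \<times> real \<Rightarrow> real) \<Rightarrow> (real \<times> real \<Rightarrow> real) \<Rightarrow>
   nat \<times> nat \<Rightarrow> side \<Rightarrow> real \<Rightarrow> real" where
  "flux_v M \<alpha> \<tau> u v K s r =
     (trace_out M v K s r + trace_in M v K s r) / 2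
     + zeta \<alpha> \<bullet> (trace_out M v K s r *\<^sub>R (- normal s) + trace_in M v K s r *\<^sub>R normal s)
     - \<tau> * grad_jump M u K s r"

subsection \<open>Projections and damping coefficients\<close>

text \<open>The projection is unique up to its values on the mesh lines.\<close>

definition L2_proj :: "mesh \<Rightarrow> nat \<Rightarrow> (real \<times> real \<Rightarrow> real) \<Rightarrow> real \<times> real \<Rightarrow> real" where
  "L2_proj M l w = (SOME g. g \<in> Vh M l \<and>
     (\<forall>K\<in>elements M. \<forall>f\<in>poly_space l. integral (rect M K) (\<lambda>z. (g z - w z) * f z) = 0))"

definition L2_proj_vec ::
  "mesh \<Rightarrow> nat \<Rightarrow> (real \<times> real \<Rightarrow> real \<times> real) \<Rightarrow> real \<times> real \<Rightarrow> real \<times> real" where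
  "L2_proj_vec M l w z = (L2_proj M l (\<lambda>y. fst (w y)) z, L2_proj M l (\<lambda>y. snd (w y)) z)"

fun vertex :: "mesh \<Rightarrow> nat \<times> nat \<Rightarrow> side \<Rightarrow> side \<Rightarrow> real \<times> real" where
  "vertex M (i, j) sx sy =
     (if sx = West then gx M (i - 1) else gx M i, if sy = South then gy M (j - 1) else gy M j)"

definition vertex_trace :: "mesh \<Rightarrow> (real \<times> real \<Rightarrow> real) \<Rightarrow> nat \<times> nat \<Rightarrow> side \<Rightarrow> side \<Rightarrow> real" where
  "vertex_trace M w K sx sy = elem_trace M w K (vertex M K sx sy)"

text \<open>
  The vertex where the sides \<open>sx\<close> (\<open>West\<close> or \<open>East\<close>) and \<open>sy\<close> (\<open>South\<close> or \<open>North\<close>) of \<open>K\<close> meet is,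
  after periodic identification, the \<open>(opposite sx, sy)\<close> vertex of the neighbour across \<open>sx\<close> and
  the \<open>(sx, opposite sy)\<close> vertex of the neighbour across \<open>sy\<close>.
\<close>

definition vertex_jump_sq :: "mesh \<Rightarrow> (real \<times> real \<Rightarrow> real) \<Rightarrow> nat \<times> nat \<Rightarrow> side \<Rightarrow> side \<Rightarrow> real" where
  "vertex_jump_sq M w K sx sy =
     (vertex_trace M w K sx sy - vertex_trace M w (neighbour M K sx) (opposite sx) sy)\<^sup>2
     + (vertex_trace M w K sx sy - vertex_trace M w (neighbour M K sy) sx (opposite sy))\<^sup>2"

definition vertex_jumps :: "mesh \<Rightarrow> nat \<Rightarrow> (real \<times> real \<Rightarrow> real) \<Rightarrow> nat \<times> nat \<Rightarrow> real" where
  "vertex_jumps M l w K =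
     (\<Sum>(a, b)\<in>{(a, b). a + b = l}.
        sqrt (1/4 * (\<Sum>sx\<in>{West, East}. \<Sum>sy\<in>{South, North}.
                       vertex_jump_sq M (partial_deriv a b w) K sx sy)))"

definition sigma_u :: "mesh \<Rightarrow> nat \<Rightarrow> (real \<times> real \<Rightarrow> real) \<Rightarrow> nat \<times> nat \<Rightarrow> nat \<Rightarrow> real" where
  "sigma_u M p u K l =
     2 * (2 * real l + 1) / (2 * real p - 1) * (diam M K ^ l / fact l) * vertex_jumps M l u K"

definition sigma_v :: "mesh \<Rightarrow> nat \<Rightarrow> (real \<times> real \<Rightarrow> real) \<Rightarrow> nat \<times> nat \<Rightarrow> nat \<Rightarrow> real" where
  "sigma_v M q v K l =
     2 * (2 * real l + 1) / (2 * real q - 1) * (diam M K ^ (l + 1) / fact (l + 1)) * vertex_jumps M l v K"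

subsection \<open>The semi-discrete scheme\<close>

text \<open>Time runs through \<open>(0, T]\<close>; the time derivative at \<open>T\<close> is one-sided.\<close>

definition time_deriv :: "real \<Rightarrow> (real \<Rightarrow> real \<times> real \<Rightarrow> real) \<Rightarrow> real \<Rightarrow> real \<times> real \<Rightarrow> real" where
  "time_deriv T w t z = vector_derivative (\<lambda>s. w s z) (at t within {0<..T})"

definition time_differentiable :: "mesh \<Rightarrow> real \<Rightarrow> (real \<Rightarrow> real \<times> real \<Rightarrow> real) \<Rightarrow> bool" where
  "time_differentiable M T w \<longleftrightarrow>
     (\<forall>t\<in>{0<..T}. \<forall>K\<in>elements M. \<forall>z\<in>interior (rect M K).
        (\<lambda>s. w s z) differentiable (at t within {0<..T}))"

definition mean_equation ::
  "mesh \<Rightarrow> (real \<times> real \<Rightarrow> real) \<Rightarrow> (real \<times> real \<Rightarrow> real) \<Rightarrow> nat \<times> nat \<Rightarrow> bool" where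
  "mean_equation M ut v K \<longleftrightarrow> integral (rect M K) (\<lambda>z. ut z - v z) = 0"

definition u_equation ::
  "mesh \<Rightarrow> nat \<Rightarrow> real \<Rightarrow> real \<Rightarrow> real \<Rightarrow> (real \<times> real \<Rightarrow> real) \<Rightarrow> (real \<times> real \<Rightarrow> real) \<Rightarrow>
   (real \<times> real \<Rightarrow> real) \<Rightarrow> nat \<times> nat \<Rightarrow> (real \<times> real \<Rightarrow> real) \<Rightarrow> bool" where
  "u_equation M p \<alpha> c \<tau> ut u v K \<phi> \<longleftrightarrow>
     integral (rect M K) (\<lambda>z. grad (\<lambda>y. ut y - v y) z \<bullet> grad \<phi> z) =
       boundary_integral M K (\<lambda>s r. (flux_v M \<alpha> \<tau> u v K s r - trace_in M v K s r)
                                     * (trace_in M (grad \<phi>) K s r \<bullet> normal s))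
       - c / (mesh_size M)\<^sup>2 *
           boundary_integral M K (\<lambda>s r. (jump M u K s r \<bullet> normal s) * trace_in M \<phi> K s r)
       - (\<Sum>l=1..p. sigma_u M p u K l / diam M K *
            integral (rect M K) (\<lambda>z. (grad u z - L2_proj_vec M (l - 1) (grad u) z) \<bullet> grad \<phi> z))"

text \<open>
  For \<open>l = 0\<close> the truncated subtraction \<open>l - 1 = 0\<close> on \<open>nat\<close> implements the convention that the
  projection of index \<open>-1\<close> is the one of index \<open>0\<close>.
\<close>

definition v_equation ::
  "mesh \<Rightarrow> nat \<Rightarrow> real \<Rightarrow> real \<Rightarrow> (real \<times> real \<Rightarrow> real) \<Rightarrow> (real \<times> real \<Rightarrow> real) \<Rightarrow>
   (real \<times> real \<Rightarrow> real) \<Rightarrow> nat \<times> nat \<Rightarrow> (real \<times> real \<Rightarrow> real) \<Rightarrow> bool" where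
  "v_equation M q \<alpha> \<beta> vt u v K \<phi> \<longleftrightarrow>
     integral (rect M K) (\<lambda>z. vt z * \<phi> z + grad u z \<bullet> grad \<phi> z) =
       boundary_integral M K (\<lambda>s r. (flux_grad M \<alpha> \<beta> u v K s r \<bullet> normal s) * trace_in M \<phi> K s r)
       - (\<Sum>l=0..q. sigma_v M q v K l / diam M K *
            integral (rect M K) (\<lambda>z. (v z - L2_proj M (l - 1) v z) * \<phi> z))"

definition OF_EDG_solution ::
  "mesh \<Rightarrow> real \<Rightarrow> nat \<Rightarrow> nat \<Rightarrow> real \<Rightarrow> real \<Rightarrow> real \<Rightarrow> real \<Rightarrow>
   (real \<Rightarrow> real \<times> real \<Rightarrow> real) \<Rightarrow> (real \<Rightarrow> real \<times> real \<Rightarrow> real) \<Rightarrow> bool" where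
  "OF_EDG_solution M T p q \<alpha> c \<tau> \<beta> u v \<longleftrightarrow>
     (\<forall>t\<in>{0<..T}. u t \<in> Vh M p \<and> v t \<in> Vh M q) \<and>
     time_differentiable M T u \<and> time_differentiable M T v \<and>
     (\<forall>t\<in>{0<..T}. \<forall>K\<in>elements M.
        mean_equation M (time_deriv T u t) (v t) K \<and>
        (\<forall>\<phi>\<in>Vh M p. u_equation M p \<alpha> c \<tau> (time_deriv T u t) (u t) (v t) K \<phi>) \<and>
        (\<forall>\<phi>\<in>Vh M q. v_equation M q \<alpha> \<beta> (time_deriv T v t) (u t) (v t) K \<phi>))"

definition energy :: "mesh \<Rightarrow> (real \<times> real \<Rightarrow> real) \<Rightarrow> (real \<times> real \<Rightarrow> real) \<Rightarrow> real" where
  "energy M u v = integral (domain_rect M) (\<lambda>z. grad u z \<bullet> grad u z + (v z)\<^sup>2)"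

end

theory Submission
  imports Defs
begin

text \<open>
  Testing the scheme with \<open>\<phi> = u_h\<close> and \<open>\<phi> = v_h\<close> and adding the two equations expresses half the
  time derivative of the energy through boundary and damping terms. The damping terms have the right
  sign because the residual of an orthogonal projection is orthogonal to the projection. In the
  boundary terms the two sides of each edge are paired: there the central and the \<open>\<alpha>\<close> parts of
  the fluxes cancel, and minus the squares of the three jumps remains, with weights \<open>\<tau>\<close>, \<open>\<beta>\<close> and
  \<open>c/h\<^sup>2\<close>. The solution is only known to be differentiable in time pointwise in space; expanding
  it on each element in a basis dual to finitely many point evaluations turns the energy into a
  quadratic polynomial in finitely many differentiable point values.
\<close>

section \<open>Finite-dimensional function spaces\<close>

text \<open>The span is taken of an indexed family, with no independence required, so that induction
  on \<open>I\<close> can add one function at a time. Both the interpolation and the projection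
  below are built this way.\<close>

definition fspan :: "'i set \<Rightarrow> ('i \<Rightarrow> 'a \<Rightarrow> real) \<Rightarrow> ('a \<Rightarrow> real) set" where
  "fspan I b = {f. \<exists>c. f = (\<lambda>x. \<Sum>i\<in>I. c i * b i x)}"

lemma fspan_lincomb:
  assumes "f \<in> fspan I b" "g \<in> fspan I b"
  shows "(\<lambda>x. r * f x + s * g x) \<in> fspan I b"
proof -
  obtain c d where "f = (\<lambda>x. \<Sum>i\<in>I. c i * b i x)" "g = (\<lambda>x. \<Sum>i\<in>I. d i * b i x)"
    using assms unfolding fspan_def by blast
  then have "(\<lambda>x. r * f x + s * g x) = (\<lambda>x. \<Sum>i\<in>I. (r * c i + s * d i) * b i x)"
    by (simp add: sum_distrib_left sum.distrib algebra_simps)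
  then show ?thesis unfolding fspan_def by (auto intro!: exI[of _ "\<lambda>i. r * c i + s * d i"])
qed

lemma fspan_zero: "(\<lambda>x. 0) \<in> fspan I b"
  unfolding fspan_def by (auto intro!: exI[of _ "\<lambda>_. 0"])

lemma fspan_scale: "f \<in> fspan I b \<Longrightarrow> (\<lambda>x. r * f x) \<in> fspan I b"
  using fspan_lincomb[of f I b f r 0] by simp

lemma fspan_diff: "f \<in> fspan I b \<Longrightarrow> g \<in> fspan I b \<Longrightarrow> (\<lambda>x. f x - g x) \<in> fspan I b"
  using fspan_lincomb[of f I b g 1 "-1"] by simp

lemma fspan_sum:
  assumes "\<And>z. z \<in> Z \<Longrightarrow> L z \<in> fspan I b"
  shows "(\<lambda>x. \<Sum>z\<in>Z. c z * L z x) \<in> fspan I b"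
proof (cases "finite Z")
  case True
  then show ?thesis using assms
  proof (induction Z rule: finite_induct)
    case (insert z Z)
    then show ?case
      using fspan_lincomb[of "L z" I b "\<lambda>x. \<Sum>z\<in>Z. c z * L z x" "c z" 1] by simp
  qed (simp add: fspan_zero)
qed (simp add: fspan_zero)

lemma fspan_insert:
  assumes "finite I" "i \<notin> I"
  shows "f \<in> fspan (insert i I) b \<longleftrightarrow> (\<exists>g\<in>fspan I b. \<exists>c. f = (\<lambda>x. g x + c * b i x))"
proof
  assume "f \<in> fspan (insert i I) b"
  then obtain c where "f = (\<lambda>x. \<Sum>j\<in>insert i I. c j * b j x)" unfolding fspan_def by blast
  then have "f = (\<lambda>x. (\<Sum>j\<in>I. c j * b j x) + c i * b i x)" using assms by (simp add: add.commute)
  then show "\<exists>g\<in>fspan I b. \<exists>c. f = (\<lambda>x. g x + c * b i x)"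
    by (intro bexI[of _ "\<lambda>x. \<Sum>j\<in>I. c j * b j x"]) (auto simp: fspan_def)
next
  assume "\<exists>g\<in>fspan I b. \<exists>c. f = (\<lambda>x. g x + c * b i x)"
  then obtain g d c where "g = (\<lambda>x. \<Sum>j\<in>I. d j * b j x)" "f = (\<lambda>x. g x + c * b i x)"
    unfolding fspan_def by auto
  then have "f = (\<lambda>x. (\<Sum>j\<in>I. d j * b j x) + c * b i x)" by simp
  also have "\<dots> = (\<lambda>x. \<Sum>j\<in>insert i I. (d(i := c)) j * b j x)"
  proof
    fix x
    have "(\<Sum>j\<in>I. (d(i := c)) j * b j x) = (\<Sum>j\<in>I. d j * b j x)"
      using assms by (intro sum.cong) auto
    then show "(\<Sum>j\<in>I. d j * b j x) + c * b i x = (\<Sum>j\<in>insert i I. (d(i := c)) j * b j x)"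
      using assms by simp
  qed
  finally show "f \<in> fspan (insert i I) b" 
    unfolding fspan_def by (intro CollectI exI[of _ "d(i := c)"])
qed

lemma fspan_insert_mono:
  assumes "finite I" "i \<notin> I" "f \<in> fspan I b"
  shows "f \<in> fspan (insert i I) b"
  unfolding fspan_insert[OF assms(1,2)] using assms(3) by (intro bexI[of _ f] exI[of _ 0]) simp_all

lemma fspan_insert_base:
  assumes "finite I" "i \<notin> I"
  shows "b i \<in> fspan (insert i I) b"
  unfolding fspan_insert[OF assms]
  by (intro bexI[of _ "\<lambda>x. 0"] exI[of _ 1]) (simp_all add: fspan_zero)

text \<open>Greedy choice of interpolation nodes in \<open>S\<close>: each new \<open>b i\<close> is
  interpolated at the nodes found so far, and a point of \<open>S\<close> where the residual is
  nonzero becomes the next node. The \<open>L z\<close> are the Lagrange functions of the nodes.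
  Coefficients thus become point values, the only quantities known to be differentiable in
  time.\<close>

lemma fspan_dual_basis:
  fixes b :: "'i \<Rightarrow> 'a \<Rightarrow> real"
  assumes "finite I"
  shows "\<exists>Z L. finite Z \<and> Z \<subseteq> S \<and> (\<forall>z\<in>Z. L z \<in> fspan I b) \<and>
      (\<forall>z\<in>Z. \<forall>y\<in>Z. L z y = (if z = y then 1 else 0)) \<and>
      (\<forall>f\<in>fspan I b. \<forall>x\<in>S. f x = (\<Sum>z\<in>Z. f z * L z x))"
  using assms
proof (induction I rule: finite_induct)
  case empty
  show ?case by (rule exI[of _ "{}"]) (auto simp: fspan_def)
next
  case (insert i I)
  from insert.IH obtain Z L where ZL: "finite Z \<and> Z \<subseteq> S \<and> (\<forall>z\<in>Z. L z \<in> fspan I b) \<and>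
    (\<forall>z\<in>Z. \<forall>y\<in>Z. L z y = (if z = y then 1 else 0)) \<and>
    (\<forall>f\<in>fspan I b. \<forall>x\<in>S. f x = (\<Sum>z\<in>Z. f z * L z x))" by (elim exE)
  then have Z: "finite Z" "Z \<subseteq> S" and L: "\<And>z. z \<in> Z \<Longrightarrow> L z \<in> fspan I b"
    and delta: "\<And>z y. z \<in> Z \<Longrightarrow> y \<in> Z \<Longrightarrow> L z y = (if z = y then 1 else 0)"
    and rep: "\<And>f x. f \<in> fspan I b \<Longrightarrow> x \<in> S \<Longrightarrow> f x = (\<Sum>z\<in>Z. f z * L z x)"
    by auto
  \<comment> \<open>The interpolation error of the new function; it vanishes at all old
    nodes.\<close>
  define e where "e x = b i x - (\<Sum>z\<in>Z. b i z * L z x)" for x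
  have L': "L z \<in> fspan (insert i I) b" if "z \<in> Z" for z
    using fspan_insert_mono[OF insert(1,2) L[OF that]] .
  have e_span: "e \<in> fspan (insert i I) b"
    unfolding e_def[abs_def]
    by (rule fspan_diff[OF fspan_insert_base[OF insert(1,2)] fspan_sum[OF L']])
  have e_Z: "e z = 0" if "z \<in> Z" for z
  proof -
    have "(\<Sum>y\<in>Z. b i y * L y z) = (\<Sum>y\<in>Z. if y = z then b i y else 0)"
      by (intro sum.cong) (auto simp: delta that)
    then show ?thesis using that Z by (simp add: e_def)
  qed
  \<comment> \<open>Modulo the old span, which interpolation reproduces on \<open>S\<close>, the
    enlarged span adds only the direction \<open>e\<close>.\<close>
  have rep': "\<exists>c. \<forall>x\<in>S. f x = (\<Sum>z\<in>Z. f z * L z x) + c * e x"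
    if f_span: "f \<in> fspan (insert i I) b" for f
  proof -
    obtain g c where g: "g \<in> fspan I b" and f: "f = (\<lambda>x. g x + c * b i x)"
      using f_span unfolding fspan_insert[OF insert(1,2)] by (elim bexE exE)
    have "f x = (\<Sum>z\<in>Z. f z * L z x) + c * e x" if "x \<in> S" for x
    proof -
      have "(\<Sum>z\<in>Z. f z * L z x) = (\<Sum>z\<in>Z. g z * L z x) + c * (\<Sum>z\<in>Z. b i z * L z x)"
        by (simp add: f distrib_right sum.distrib sum_distrib_left mult.assoc)
      then show ?thesis
        using rep[OF g that] by (simp add: f e_def right_diff_distrib)
    qed
    then show ?thesis by blast
  qed
  show ?case
  proof (cases "\<forall>x\<in>S. e x = 0")
    case True
    \<comment> \<open>The new function adds nothing on \<open>S\<close>, so the old nodes still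
      suffice.\<close>
    have "f x = (\<Sum>z\<in>Z. f z * L z x)" if "f \<in> fspan (insert i I) b" "x \<in> S" for f x
      using rep'[OF that(1)] True that(2) by auto
    then show ?thesis using Z L' delta
      by (intro exI[of _ Z] exI[of _ L] conjI ballI)
  next
    case False
    then obtain y where y: "y \<in> S" "e y \<noteq> 0" by blast
    then have "y \<notin> Z" using e_Z by blast
    \<comment> \<open>\<open>e / e y\<close> is already the Lagrange function of \<open>y\<close>,
      as \<open>e\<close> vanishes on \<open>Z\<close>. Each old \<open>L z\<close> is corrected by
      the multiple of it that makes it vanish at \<open>y\<close>.\<close>
    define N where "N z x = (if z = y then e x / e y else L z x - L z y * (e x / e y))" for z x
    have N_y: "N y x = e x / e y" for x by (simp add: N_def)
    have N_Z: "N z x = L z x - L z y * (e x / e y)" if "z \<in> Z" for z x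
      using that \<open>y \<notin> Z\<close> by (auto simp: N_def)
    have "N z \<in> fspan (insert i I) b" if "z \<in> insert y Z" for z
    proof (cases "z = y")
      case True
      then show ?thesis
        using fspan_scale[OF e_span, of "1 / e y"] by (simp add: N_def[abs_def])
    next
      case False
      then have "L z \<in> fspan (insert i I) b" using that L' by blast
      from fspan_lincomb[OF this e_span, of 1 "- L z y / e y"] False
      show ?thesis by (simp add: N_def[abs_def])
    qed
    moreover have "N z x = (if z = x then 1 else 0)" if "z \<in> insert y Z" "x \<in> insert y Z" for z x
      using that \<open>y \<notin> Z\<close> y e_Z delta by (auto simp: N_def)
    moreover have "f x = (\<Sum>z\<in>insert y Z. f z * N z x)"
      if f: "f \<in> fspan (insert i I) b" and x: "x \<in> S" for f x
    proof -
      obtain c where c: "\<And>x. x \<in> S \<Longrightarrow> f x = (\<Sum>z\<in>Z. f z * L z x) + c * e x"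
        using rep'[OF f] by blast
      have "(\<Sum>z\<in>Z. f z * N z x) = (\<Sum>z\<in>Z. f z * L z x) - (\<Sum>z\<in>Z. f z * L z y) * (e x / e y)"
        by (simp add: N_Z right_diff_distrib sum_subtractf sum_distrib_right mult.assoc
            del: times_divide_eq_right)
      \<comment> \<open>Evaluation at the node \<open>y\<close> eliminates the unknown coefficient
        \<open>c\<close>.\<close>
      moreover have "f y * (e x / e y) = (\<Sum>z\<in>Z. f z * L z y) * (e x / e y) + c * e x"
        unfolding c[OF y(1)] distrib_right using y(2) by simp
      ultimately show ?thesis
        using Z \<open>y \<notin> Z\<close> c[OF x] by (simp add: N_y)
    qed
    moreover have "finite (insert y Z)" "insert y Z \<subseteq> S" using Z y(1) by auto
    ultimately show ?thesis
      by (intro exI[of _ "insert y Z"] exI[of _ N] conjI ballI)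
  qed
qed

section \<open>Orthogonal projection\<close>

definition l2_prod :: "(real \<times> real) set \<Rightarrow> (real \<times> real \<Rightarrow> real) \<Rightarrow> (real \<times> real \<Rightarrow> real) \<Rightarrow> real" where
  "l2_prod R f g = integral R (\<lambda>z. f z * g z)"

lemma l2_prod_commute: "l2_prod R f g = l2_prod R g f"
  by (simp add: l2_prod_def mult.commute)

lemma l2_prod_lincomb:
  assumes "continuous_on (cbox a b) f" "continuous_on (cbox a b) g" "continuous_on (cbox a b) h"
  shows "l2_prod (cbox a b) (\<lambda>z. r * f z + s * g z) h =
    r * l2_prod (cbox a b) f h + s * l2_prod (cbox a b) g h"
proof -
  have "(\<lambda>z. f z * h z) integrable_on cbox a b" "(\<lambda>z. g z * h z) integrable_on cbox a b"
    by (intro integrable_continuous continuous_intros assms)+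
  then show ?thesis
    unfolding l2_prod_def
    using integral_add[OF integrable_on_cmult_left[of "\<lambda>z. f z * h z" _ r]
        integrable_on_cmult_left[of "\<lambda>z. g z * h z" _ s], of "cbox a b"]
    by (simp add: distrib_right mult.assoc)
qed

lemma l2_prod_lincomb_right:
  assumes "continuous_on (cbox a b) f" "continuous_on (cbox a b) g" "continuous_on (cbox a b) h"
  shows "l2_prod (cbox a b) h (\<lambda>z. r * f z + s * g z) =
    r * l2_prod (cbox a b) h f + s * l2_prod (cbox a b) h g"
  using l2_prod_lincomb[OF assms] by (simp add: l2_prod_commute)

lemma l2_prod_sum:
  assumes "\<And>z. z \<in> Z \<Longrightarrow> continuous_on (cbox a b) (F z)" "continuous_on (cbox a b) h"
  shows "l2_prod (cbox a b) (\<lambda>x. \<Sum>z\<in>Z. r z * F z x) h = (\<Sum>z\<in>Z. r z * l2_prod (cbox a b) (F z) h)"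
proof (cases "finite Z")
  case True
  then show ?thesis using assms(1)
  proof (induction Z rule: finite_induct)
    case empty
    show ?case by (simp add: l2_prod_def)
  next
    case (insert z Z)
    then show ?case
      using l2_prod_lincomb[of a b "F z" "\<lambda>x. \<Sum>z\<in>Z. r z * F z x" h "r z" 1] assms(2)
      by (simp add: continuous_on_sum continuous_on_mult_left)
  qed
qed (simp add: l2_prod_def)

text \<open>Continuity is not assumed: a square that is not integrable has integral 0 by
  default.\<close>

lemma l2_prod_self_nonneg: "0 \<le> l2_prod (cbox a b) f f"
  unfolding l2_prod_def by (cases "(\<lambda>z. f z * f z) integrable_on cbox a b")
    (auto intro: integral_nonneg simp: not_integrable_integral)

text \<open>A continuous function with zero norm vanishes on a box with nonempty interior. On a
  degenerate box it need not vanish, but there every integral is 0; hence the conclusion is about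
  the pairing and not about \<open>f\<close> itself.\<close>

lemma l2_prod_self_eq_0:
  assumes "continuous_on (cbox a b) f" "l2_prod (cbox a b) f f = 0" "continuous_on (cbox a b) g"
  shows "l2_prod (cbox a b) g f = 0"
proof (cases "box a b = {}")
  case True
  then show ?thesis unfolding l2_prod_def by (simp add: content_eq_0_interior)
next
  case False
  have c: "continuous_on (cbox a b) (\<lambda>z. f z * f z)" by (intro continuous_intros assms)
  then have "((\<lambda>z. f z * f z) has_integral 0) (cbox a b)"
    using integrable_integral[OF integrable_continuous[OF c]] assms(2) unfolding l2_prod_def by simp
  then have "f z * f z = 0" if "z \<in> cbox a b" for z
    by (rule has_integral_0_cbox_imp_0[OF c _ _ False that, rotated]) simp
  then have "integral (cbox a b) (\<lambda>z. g z * f z) = integral (cbox a b) (\<lambda>z. 0)"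
    by (intro integral_cong) auto
  then show ?thesis unfolding l2_prod_def by simp
qed

lemma fspan_continuous:
  assumes "\<And>i. i \<in> I \<Longrightarrow> continuous_on R (b i)" "f \<in> fspan I b"
  shows "continuous_on R f"
proof -
  obtain c where "f = (\<lambda>x. \<Sum>i\<in>I. c i * b i x)" using assms(2) unfolding fspan_def by blast
  then show ?thesis using assms(1) by (auto intro!: continuous_intros)
qed

text \<open>A Gram-Schmidt step. The projection \<open>g\<close> onto the smaller span is corrected
  by a multiple of \<open>e\<close>, the component of \<open>b i\<close> orthogonal to that span up
  to sign. The induction hypothesis is used for two targets, \<open>w\<close> and
  \<open>b i\<close>, which is why \<open>w\<close> is generalized.\<close>

lemma fspan_projection:
  assumes "finite I" "\<And>i. i \<in> I \<Longrightarrow> continuous_on (cbox a c) (b i)" "continuous_on (cbox a c) w"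
  shows "\<exists>g\<in>fspan I b. \<forall>f\<in>fspan I b. l2_prod (cbox a c) (\<lambda>z. g z - w z) f = 0"
  using assms
proof (induction I arbitrary: w rule: finite_induct)
  case empty
  show ?case by (auto simp: fspan_def l2_prod_def)
next
  case (insert i I)
  let ?R = "cbox a c"
  have cont: "continuous_on ?R f" if "f \<in> fspan (insert i I) b" for f
    using fspan_continuous[OF insert(4) that] by blast
  have mono: "f \<in> fspan (insert i I) b" if "f \<in> fspan I b" for f
    using fspan_insert_mono[OF insert(1,2) that] .
  note base = fspan_insert_base[OF insert(1,2), of b]
  obtain g where g: "g \<in> fspan I b" "\<And>f. f \<in> fspan I b \<Longrightarrow> l2_prod ?R (\<lambda>z. g z - w z) f = 0"
    using insert.IH[OF _ insert.prems(2)] insert.prems(1) by auto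
  obtain h where h: "h \<in> fspan I b" "\<And>f. f \<in> fspan I b \<Longrightarrow> l2_prod ?R (\<lambda>z. h z - b i z) f = 0"
    using insert.IH[of "b i"] insert.prems(1) by auto
  define e where "e z = h z - b i z" for z
  have e: "e \<in> fspan (insert i I) b"
    unfolding e_def by (intro fspan_diff mono h base)
  have cgw: "continuous_on ?R (\<lambda>z. g z - w z)"
    using cont[OF mono[OF g(1)]] insert.prems(2) by (intro continuous_intros)
  \<comment> \<open>If \<open>e\<close> vanishes, so does \<open>k\<close>, by division by zero.\<close>
  define k where "k = - l2_prod ?R (\<lambda>z. g z - w z) e / l2_prod ?R e e"
  have 1: "l2_prod ?R (\<lambda>z. g z - w z) e + k * l2_prod ?R e e = 0"
    using l2_prod_self_eq_0[OF cont[OF e] _ cgw] by (cases "l2_prod ?R e e = 0") (auto simp: k_def)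
  have 2: "l2_prod ?R e f = 0" if "f \<in> fspan I b" for f
    using h(2)[OF that] by (simp add: e_def[abs_def])
  show ?case
  proof (intro bexI ballI)
    fix f assume "f \<in> fspan (insert i I) b"
    then obtain f0 d where f0: "f0 \<in> fspan I b" and f: "f = (\<lambda>x. f0 x + d * b i x)"
      unfolding fspan_insert[OF insert(1,2)] by (elim bexE exE)
    \<comment> \<open>Since \<open>b i = h - e\<close>, the test function splits into
      \<open>f1\<close> in the old span and \<open>-d\<close> times \<open>e\<close>. The factors 1
      here and below give the sums the shape of the bilinearity lemmas.\<close>
    define f1 where "f1 = (\<lambda>x. 1 * f0 x + d * h x)"
    have f1: "f1 \<in> fspan I b" unfolding f1_def by (intro fspan_lincomb f0 h)
    have f_eq: "f = (\<lambda>x. 1 * f1 x + (-d) * e x)"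
      by (simp add: f f1_def e_def fun_eq_iff algebra_simps)
    have "l2_prod ?R (\<lambda>z. 1 * (g z - w z) + k * e z) f =
        1 * l2_prod ?R (\<lambda>z. g z - w z) f + k * l2_prod ?R e f"
      unfolding f_eq by (intro l2_prod_lincomb cgw cont e continuous_intros mono f1)
    also have "l2_prod ?R (\<lambda>z. g z - w z) f = -d * l2_prod ?R (\<lambda>z. g z - w z) e"
      unfolding f_eq using g(2)[OF f1] by (subst l2_prod_lincomb_right) (auto intro!: cgw cont e mono f1)
    also have "l2_prod ?R e f = -d * l2_prod ?R e e"
      unfolding f_eq using 2[OF f1] by (subst l2_prod_lincomb_right) (auto intro!: cont e mono f1)
    finally have "l2_prod ?R (\<lambda>z. 1 * (g z - w z) + k * e z) f =
        -d * (l2_prod ?R (\<lambda>z. g z - w z) e + k * l2_prod ?R e e)"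
      by (simp add: algebra_simps)
    then have "l2_prod ?R (\<lambda>z. 1 * (g z - w z) + k * e z) f = 0" unfolding 1 by simp
    then show "l2_prod ?R (\<lambda>z. (1 * g z + k * e z) - w z) f = 0"
      by (simp add: algebra_simps)
  next
    show "(\<lambda>z. 1 * g z + k * e z) \<in> fspan (insert i I) b"
      by (intro fspan_lincomb mono g e)
  qed
qed

section \<open>Polynomials in two variables\<close>

definition monom2 :: "nat \<times> nat \<Rightarrow> real \<times> real \<Rightarrow> real" where
  "monom2 e z = fst z ^ fst e * snd z ^ snd e"

lemma finite_degree_le: "finite {(a::nat, b). a + b \<le> k}"
  by (rule finite_subset[of _ "{..k} \<times> {..k}"]) auto

lemma poly_space_eq_fspan: "poly_space k = fspan {(a, b). a + b \<le> k} monom2"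
proof (intro equalityI subsetI)
  fix f assume "f \<in> poly_space k"
  then obtain c where "\<And>x y. f (x, y) = (\<Sum>(a, b)\<in>{(a, b). a + b \<le> k}. c a b * x ^ a * y ^ b)"
    unfolding poly_space_def by auto
  then have "f = (\<lambda>z. \<Sum>e\<in>{(a, b). a + b \<le> k}. c (fst e) (snd e) * monom2 e z)"
    by (auto simp: fun_eq_iff monom2_def mult.assoc intro!: sum.cong)
  then show "f \<in> fspan {(a, b). a + b \<le> k} monom2"
    unfolding fspan_def by (intro CollectI exI[of _ "\<lambda>e. c (fst e) (snd e)"])
next
  fix f assume "f \<in> fspan {(a, b). a + b \<le> k} monom2"
  then obtain c where "f = (\<lambda>z. \<Sum>e\<in>{(a, b). a + b \<le> k}. c e * monom2 e z)"
    unfolding fspan_def by auto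
  then show "f \<in> poly_space k"
    unfolding poly_space_def
    by (auto simp: monom2_def mult.assoc intro!: exI[of _ "\<lambda>a b. c (a, b)"] sum.cong)
qed

text \<open>Differentiability is required separately because \<open>deriv\<close> is total:
  continuity of \<open>dx f\<close> and \<open>dy f\<close> would not by itself make them true
  derivatives.\<close>

definition C1_fun :: "(real \<times> real \<Rightarrow> real) \<Rightarrow> bool" where
  "C1_fun f \<longleftrightarrow> continuous_on UNIV f \<and> continuous_on UNIV (dx f) \<and> continuous_on UNIV (dy f) \<and>
     (\<forall>z. (\<lambda>s. f (s, snd z)) field_differentiable at (fst z)) \<and>
     (\<forall>z. (\<lambda>s. f (fst z, s)) field_differentiable at (snd z))"

lemma C1_fun_I:
  assumes "\<And>z. ((\<lambda>s. f (s, snd z)) has_field_derivative fx z) (at (fst z))"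
    and "\<And>z. ((\<lambda>s. f (fst z, s)) has_field_derivative fy z) (at (snd z))"
    and "continuous_on UNIV f" "continuous_on UNIV fx" "continuous_on UNIV fy"
  shows "C1_fun f" and "dx f = fx" and "dy f = fy"
proof -
  show 1: "dx f = fx" "dy f = fy"
    using assms(1,2) by (auto simp: fun_eq_iff dx_def dy_def intro!: DERIV_imp_deriv)
  show "C1_fun f"
    unfolding C1_fun_def field_differentiable_def 1 using assms by (intro conjI allI exI)
qed

lemma C1_fun_D:
  assumes "C1_fun f"
  shows "((\<lambda>s. f (s, snd z)) has_field_derivative dx f z) (at (fst z))"
    and "((\<lambda>s. f (fst z, s)) has_field_derivative dy f z) (at (snd z))"
    and "continuous_on S (dx f)" "continuous_on S (dy f)" "continuous_on S f"
  using assms unfolding C1_fun_def dx_def dy_def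
  by (auto intro: field_differentiable_derivI continuous_on_subset)

lemma C1_fun_sum:
  assumes "\<And>i. i \<in> I \<Longrightarrow> C1_fun (F i)"
  shows "C1_fun (\<lambda>z. \<Sum>i\<in>I. c i * F i z)"
    and "dx (\<lambda>z. \<Sum>i\<in>I. c i * F i z) = (\<lambda>z. \<Sum>i\<in>I. c i * dx (F i) z)"
    and "dy (\<lambda>z. \<Sum>i\<in>I. c i * F i z) = (\<lambda>z. \<Sum>i\<in>I. c i * dy (F i) z)"
proof -
  note * = C1_fun_I[of "\<lambda>z. \<Sum>i\<in>I. c i * F i z" "\<lambda>z. \<Sum>i\<in>I. c i * dx (F i) z"
      "\<lambda>z. \<Sum>i\<in>I. c i * dy (F i) z"]
  show "C1_fun (\<lambda>z. \<Sum>i\<in>I. c i * F i z)"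
    "dx (\<lambda>z. \<Sum>i\<in>I. c i * F i z) = (\<lambda>z. \<Sum>i\<in>I. c i * dx (F i) z)"
    "dy (\<lambda>z. \<Sum>i\<in>I. c i * F i z) = (\<lambda>z. \<Sum>i\<in>I. c i * dy (F i) z)"
    by (rule *; intro DERIV_sum DERIV_cmult continuous_on_sum continuous_on_mult_left C1_fun_D assms; assumption)+
qed

lemma C1_fun_diff:
  assumes "C1_fun f" "C1_fun g"
  shows "C1_fun (\<lambda>z. f z - g z)"
    and "dx (\<lambda>z. f z - g z) = (\<lambda>z. dx f z - dx g z)"
    and "dy (\<lambda>z. f z - g z) = (\<lambda>z. dy f z - dy g z)"
proof -
  note * = C1_fun_I[of "\<lambda>z. f z - g z" "\<lambda>z. dx f z - dx g z" "\<lambda>z. dy f z - dy g z"]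
  show "C1_fun (\<lambda>z. f z - g z)" "dx (\<lambda>z. f z - g z) = (\<lambda>z. dx f z - dx g z)"
    "dy (\<lambda>z. f z - g z) = (\<lambda>z. dy f z - dy g z)"
    by (rule *[OF DERIV_diff DERIV_diff continuous_on_diff continuous_on_diff continuous_on_diff];
        (rule C1_fun_D assms)+)+
qed

lemma C1_fun_monom2: "C1_fun (monom2 e)"
  by (rule C1_fun_I[of _ "\<lambda>z. real (fst e) * fst z ^ (fst e - 1) * snd z ^ snd e"
        "\<lambda>z. fst z ^ fst e * (real (snd e) * snd z ^ (snd e - 1))"])
     (auto simp: monom2_def[abs_def] intro!: continuous_intros derivative_eq_intros)

lemma C1_fun_poly: "f \<in> poly_space k \<Longrightarrow> C1_fun f"
  unfolding poly_space_eq_fspan fspan_def using C1_fun_sum(1)[OF C1_fun_monom2] by auto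

text \<open>Derivatives depend only on the germ, and equality near \<open>z\<close> restricts to
  both coordinate lines through \<open>z\<close>. On an open element, pointwise derivatives of a
  broken function can therefore be computed on its polynomial.\<close>

lemma dx_dy_cong:
  assumes "open S" "z \<in> S" "\<And>y. y \<in> S \<Longrightarrow> f y = g y"
  shows "dx f z = dx g z" "dy f z = dy g z" "grad f z = grad g z"
proof -
  have ev: "\<forall>\<^sub>F y in nhds z. f y = g y"
    using assms eventually_nhds by blast
  have "((\<lambda>s. (s, snd z)) \<longlongrightarrow> (fst z, snd z)) (nhds (fst z))"
    "((\<lambda>s. (fst z, s)) \<longlongrightarrow> (fst z, snd z)) (nhds (snd z))"
    by (intro tendsto_Pair tendsto_const filterlim_ident)+
  then have "\<forall>\<^sub>F s in nhds (fst z). f (s, snd z) = g (s, snd z)"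
    "\<forall>\<^sub>F s in nhds (snd z). f (fst z, s) = g (fst z, s)"
    using ev by (auto simp: filterlim_iff)
  then show "dx f z = dx g z" "dy f z = dy g z"
    unfolding dx_def dy_def by (auto intro: deriv_cong_ev)
  then show "grad f z = grad g z" by (simp add: grad_def)
qed

lemma continuous_on_grad: "C1_fun f \<Longrightarrow> continuous_on S (grad f)"
  unfolding grad_def[abs_def] by (intro continuous_intros C1_fun_D)

section \<open>Elements of the mesh\<close>

lemma grid_mono:
  fixes g :: "nat \<Rightarrow> real"
  assumes "\<And>i. i < n \<Longrightarrow> g i < g (Suc i)" "i \<le> j" "j \<le> n"
  shows "g i \<le> g j"
  using assms(2,3)
proof (induction j rule: dec_induct)
  case (step k)
  then show ?case using assms(1)[of k] by simp
qed simp

lemma valid_mesh_D: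
  assumes "valid_mesh M"
  shows "\<And>i j. i \<le> j \<Longrightarrow> j \<le> nx M \<Longrightarrow> gx M i \<le> gx M j"
    and "\<And>i j. i \<le> j \<Longrightarrow> j \<le> ny M \<Longrightarrow> gy M i \<le> gy M j"
    and "\<And>i. 1 \<le> i \<Longrightarrow> i \<le> nx M \<Longrightarrow> gx M (i - 1) < gx M i"
    and "\<And>j. 1 \<le> j \<Longrightarrow> j \<le> ny M \<Longrightarrow> gy M (j - 1) < gy M j"
proof -
  have x: "\<And>i. i < nx M \<Longrightarrow> gx M i < gx M (Suc i)" and y: "\<And>j. j < ny M \<Longrightarrow> gy M j < gy M (Suc j)"
    using assms by (auto simp: valid_mesh_def)
  show "\<And>i j. i \<le> j \<Longrightarrow> j \<le> nx M \<Longrightarrow> gx M i \<le> gx M j"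
    "\<And>i j. i \<le> j \<Longrightarrow> j \<le> ny M \<Longrightarrow> gy M i \<le> gy M j"
    using grid_mono x y by metis+
  show "\<And>i. 1 \<le> i \<Longrightarrow> i \<le> nx M \<Longrightarrow> gx M (i - 1) < gx M i"
    "\<And>j. 1 \<le> j \<Longrightarrow> j \<le> ny M \<Longrightarrow> gy M (j - 1) < gy M j"
    subgoal for i using x[of "i - 1"] by simp
    subgoal for j using y[of "j - 1"] by simp
    done
qed

lemma rect_cbox: obtains a b where "rect M K = cbox a b"
  by (cases K) auto

lemma interior_rect_nonempty:
  assumes "valid_mesh M" "K \<in> elements M"
  shows "interior (rect M K) \<noteq> {}"
proof -
  obtain i j where K: "K = (i, j)" by (cases K)
  then show ?thesis
    using valid_mesh_D(3)[OF assms(1), of i] valid_mesh_D(4)[OF assms(1), of j] assms(2)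
    by (simp add: elements_def box_ne_empty Basis_prod_def)
qed

text \<open>The frontier of a box is negligible, so the values that \<open>Vh\<close> leaves
  arbitrary on mesh lines do not affect volume integrals.\<close>

lemma integral_rect_cong:
  assumes "\<And>z. z \<in> interior (rect M K) \<Longrightarrow> f z = g z"
  shows "integral (rect M K) f = integral (rect M K) g"
proof -
  obtain a b where ab: "rect M K = cbox a b" by (rule rect_cbox)
  show ?thesis
    using assms integral_spike[OF negligible_frontier_interval[of a b], of "cbox a b" g f]
    by (simp add: ab)
qed

lemma integrable_rect:
  fixes f :: "real \<times> real \<Rightarrow> real"
  assumes "continuous_on (rect M K) f"
  shows "f integrable_on rect M K"
  using assms by (metis rect_cbox integrable_continuous)

text \<open>\<open>Lim\<close> is meaningful only along a nontrivial filter. An element is the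
  closure of its nonempty interior, so each of its points is a limit point of that interior, and the
  limit is the value of the continuous extension.\<close>

lemma elem_trace_eq:
  assumes "valid_mesh M" "K \<in> elements M" "z \<in> rect M K" "continuous_on UNIV f"
    and "\<And>y. y \<in> interior (rect M K) \<Longrightarrow> w y = f y"
  shows "elem_trace M w K z = f z"
proof -
  let ?S = "interior (rect M K)"
  obtain a b where ab: "rect M K = cbox a b" by (rule rect_cbox)
  have ne: "box a b \<noteq> {}" using interior_rect_nonempty[OF assms(1,2)] by (simp add: ab)
  have "z islimpt ?S"
  proof (cases "z \<in> ?S")
    case True
    then show ?thesis by (simp add: interior_limit_point interior_interior)
  next
    case False
    have "z \<in> closure ?S" using assms(3) ne by (simp add: ab)
    then show ?thesis using False by (simp add: closure_def)
  qed
  then have nt: "at z within ?S \<noteq> bot" by (simp add: trivial_limit_within)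
  have "(f \<longlongrightarrow> f z) (at z within ?S)"
    using assms(4) by (meson continuous_on_def UNIV_I subset_UNIV tendsto_within_subset)
  moreover have "\<forall>\<^sub>F y in at z within ?S. f y = w y"
    using assms(5) by (auto simp: eventually_at_filter)
  ultimately have "(w \<longlongrightarrow> f z) (at z within ?S)"
    by (rule Lim_transform_eventually)
  then show ?thesis unfolding elem_trace_def using nt by (intro tendsto_Lim)
qed

lemma negligible_rect_Int:
  assumes "valid_mesh M" "K \<in> elements M" "K' \<in> elements M" "K \<noteq> K'"
  shows "negligible (rect M K \<inter> rect M K')"
proof -
  \<comment> \<open>Two distinct elements differ in some index; up to exchanging them that index
    increases, and their intersection then lies in a degenerate box on one grid line.\<close>
  have *: "negligible (rect M (i, j) \<inter> rect M (i', j'))"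
    if "(i, j) \<in> elements M" "(i', j') \<in> elements M" "i < i' \<or> j < j'" for i j i' j'
    using that(3)
  proof
    assume "i < i'"
    then have "gx M i \<le> gx M (i' - 1)"
      using that valid_mesh_D(1)[OF assms(1)] by (auto simp: elements_def)
    then have "rect M (i, j) \<inter> rect M (i', j') \<subseteq> cbox (gx M i, gy M (j - 1)) (gx M i, gy M j)"
      by auto
    moreover have "negligible (cbox (gx M i, gy M (j - 1)) (gx M i, gy M j))"
      by (simp add: negligible_interval box_eq_empty Basis_prod_def)
    ultimately show ?thesis using negligible_subset by blast
  next
    assume "j < j'"
    then have "gy M j \<le> gy M (j' - 1)"
      using that valid_mesh_D(2)[OF assms(1)] by (auto simp: elements_def)
    then have "rect M (i, j) \<inter> rect M (i', j') \<subseteq> cbox (gx M (i - 1), gy M j) (gx M i, gy M j)"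
      by auto
    moreover have "negligible (cbox (gx M (i - 1), gy M j) (gx M i, gy M j))"
      by (simp add: negligible_interval box_eq_empty Basis_prod_def)
    ultimately show ?thesis using negligible_subset by blast
  qed
  obtain i j i' j' where "K = (i, j)" "K' = (i', j')" by (cases K, cases K')
  then show ?thesis
    using *[of i j i' j'] *[of i' j' i j] assms by (auto simp: Int_commute neq_iff)
qed

text \<open>A common interior point would make the overlap contain a nonempty open set, which is not
  negligible. This makes gluing element by element well defined.\<close>

lemma disjoint_interior_rect:
  assumes "valid_mesh M" "K \<in> elements M" "K' \<in> elements M"
    and "z \<in> interior (rect M K)" "z \<in> interior (rect M K')"
  shows "K = K'"
proof (rule ccontr)
  assume "K \<noteq> K'"
  then have "negligible (interior (rect M K) \<inter> interior (rect M K'))"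
    using negligible_rect_Int[OF assms(1-3)] interior_subset
    by (meson Int_mono negligible_subset)
  then show False
    using assms(4,5) open_not_negligible[of "interior (rect M K) \<inter> interior (rect M K')"] by blast
qed

lemma grid_cover:
  fixes g :: "nat \<Rightarrow> real"
  assumes "g 0 \<le> x" "x \<le> g n" "1 \<le> n"
  shows "\<exists>i\<in>{1..n}. g (i - 1) \<le> x \<and> x \<le> g i"
  using assms(3,2)
proof (induction n rule: dec_induct)
  case base
  then show ?case using assms(1) by auto
next
  case (step n)
  show ?case
  proof (cases "x \<le> g n")
    case True
    then show ?thesis using step.IH by (auto intro: bexI)
  next
    case False
    then show ?thesis using step by (intro bexI[of _ "Suc n"]) auto
  qed
qed

lemma Union_rect:
  assumes "valid_mesh M"
  shows "(\<Union>K\<in>elements M. rect M K) = domain_rect M"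
proof (intro equalityI subsetI)
  fix z assume "z \<in> (\<Union>K\<in>elements M. rect M K)"
  then obtain i j where "1 \<le> i" "i \<le> nx M" "1 \<le> j" "j \<le> ny M" "z \<in> rect M (i, j)"
    by (auto simp: elements_def)
  moreover from this have "i - 1 \<le> nx M" "j - 1 \<le> ny M" by simp_all
  ultimately show "z \<in> domain_rect M"
    using valid_mesh_D(1)[OF assms, of 0 "i - 1"] valid_mesh_D(1)[OF assms, of i "nx M"]
      valid_mesh_D(2)[OF assms, of 0 "j - 1"] valid_mesh_D(2)[OF assms, of j "ny M"]
    by (cases z) (auto simp: domain_rect_def)
next
  fix z assume z: "z \<in> domain_rect M"
  obtain x y where xy: "z = (x, y)" by (cases z)
  obtain i where "i \<in> {1..nx M}" "gx M (i - 1) \<le> x" "x \<le> gx M i"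
    using grid_cover[of "gx M" x "nx M"] z assms
    by (auto simp: xy domain_rect_def valid_mesh_def)
  moreover obtain j where "j \<in> {1..ny M}" "gy M (j - 1) \<le> y" "y \<le> gy M j"
    using grid_cover[of "gy M" y "ny M"] z assms
    by (auto simp: xy domain_rect_def valid_mesh_def)
  ultimately show "z \<in> (\<Union>K\<in>elements M. rect M K)"
    by (intro UN_I[of "(i, j)"]) (auto simp: xy elements_def)
qed

lemma finite_elements: "finite (elements M)"
  by (simp add: elements_def)

lemma integral_domain_rect:
  fixes f :: "real \<times> real \<Rightarrow> real"
  assumes "valid_mesh M"
    and "\<And>K. K \<in> elements M \<Longrightarrow> f integrable_on rect M K"
  shows "integral (domain_rect M) f = (\<Sum>K\<in>elements M. integral (rect M K) f)"
  unfolding Union_rect[OF assms(1), symmetric]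
  using assms by (intro integral_unique has_integral_UN finite_elements integrable_integral)
    (auto simp: pairwise_def intro: negligible_rect_Int)

section \<open>Broken functions, their projections and traces\<close>

text \<open>The extension \<open>W\<close> is continuous on the whole plane, so traces can be read
  off from it at boundary points. The codomain is general in order to cover gradients.\<close>

definition broken_cont :: "mesh \<Rightarrow> (real \<times> real \<Rightarrow> 'a::real_normed_vector) \<Rightarrow> bool" where
  "broken_cont M w \<longleftrightarrow>
     (\<forall>K\<in>elements M. \<exists>W. continuous_on UNIV W \<and> (\<forall>z\<in>interior (rect M K). w z = W z))"

lemma broken_contE:
  assumes "broken_cont M w" "K \<in> elements M"
  obtains W where "\<And>S. continuous_on S W" "\<And>z. z \<in> interior (rect M K) \<Longrightarrow> w z = W z"
  using assms unfolding broken_cont_def by (metis continuous_on_subset subset_UNIV)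

lemma VhE:
  assumes "w \<in> Vh M k" "K \<in> elements M"
  obtains W where "W \<in> poly_space k" "C1_fun W"
    "\<And>z. z \<in> interior (rect M K) \<Longrightarrow> w z = W z"
    "\<And>z. z \<in> interior (rect M K) \<Longrightarrow> dx w z = dx W z"
    "\<And>z. z \<in> interior (rect M K) \<Longrightarrow> dy w z = dy W z"
    "\<And>z. z \<in> interior (rect M K) \<Longrightarrow> grad w z = grad W z"
proof -
  obtain W where W: "W \<in> poly_space k" "\<And>z. z \<in> interior (rect M K) \<Longrightarrow> w z = W z"
    using assms unfolding Vh_def by auto
  show thesis
    using W C1_fun_poly[OF W(1)] dx_dy_cong[OF open_interior _ W(2)] by (intro that[of W]) auto
qed

lemma Vh_broken_cont:
  assumes "w \<in> Vh M k"
  shows "broken_cont M w" "broken_cont M (dx w)" "broken_cont M (dy w)" "broken_cont M (grad w)"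
proof -
  show "broken_cont M w" "broken_cont M (dx w)"  "broken_cont M (dy w)" "broken_cont M (grad w)"
    unfolding broken_cont_def
    by (safe; rule VhE[OF assms], assumption, intro exI conjI ballI,
        (rule C1_fun_D continuous_on_grad, assumption), simp)+
qed

text \<open>\<^const>\<open>L2_proj\<close> is a \<open>SOME\<close>, which says nothing until a projection is shown to exist.\<close>

lemma L2_proj_works:
  assumes "valid_mesh M" "broken_cont M w"
  shows "L2_proj M l w \<in> Vh M l \<and>
    (\<forall>K\<in>elements M. \<forall>f\<in>poly_space l. integral (rect M K) (\<lambda>z. (L2_proj M l w z - w z) * f z) = 0)"
proof -
  have "\<forall>K\<in>elements M. \<exists>g. g \<in> poly_space l \<and> (\<forall>f\<in>poly_space l.
      integral (rect M K) (\<lambda>z. (g z - w z) * f z) = 0)"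
  proof
    fix K assume K: "K \<in> elements M"
    obtain W where W: "\<And>S. continuous_on S W" "\<And>z. z \<in> interior (rect M K) \<Longrightarrow> w z = W z"
      using broken_contE[OF assms(2) K] by blast
    obtain a b where ab: "rect M K = cbox a b" by (rule rect_cbox)
    have "\<exists>g\<in>poly_space l. \<forall>f\<in>poly_space l. l2_prod (rect M K) (\<lambda>z. g z - W z) f = 0"
      unfolding ab poly_space_eq_fspan
      by (intro fspan_projection finite_degree_le W C1_fun_D(5)[OF C1_fun_monom2])
    moreover have "integral (rect M K) (\<lambda>z. (g z - w z) * f z) = l2_prod (rect M K) (\<lambda>z. g z - W z) f"
      for f g unfolding l2_prod_def using W(2) by (intro integral_rect_cong) simp
    ultimately show "\<exists>g. g \<in> poly_space l \<and> (\<forall>f\<in>poly_space l.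
      integral (rect M K) (\<lambda>z. (g z - w z) * f z) = 0)" by auto
  qed
  from bchoice[OF this] obtain G where "\<forall>K\<in>elements M. G K \<in> poly_space l \<and>
      (\<forall>f\<in>poly_space l. integral (rect M K) (\<lambda>z. (G K z - w z) * f z) = 0)" by (elim exE)
  then have G: "\<And>K. K \<in> elements M \<Longrightarrow> G K \<in> poly_space l"
    "\<And>K f. K \<in> elements M \<Longrightarrow> f \<in> poly_space l \<Longrightarrow>
      integral (rect M K) (\<lambda>z. (G K z - w z) * f z) = 0"
    by auto
  \<comment> \<open>The predicate inside the choice that defines \<open>L2_proj\<close>; a witness
    for it is enough.\<close>
  define Q where "Q g \<longleftrightarrow> g \<in> Vh M l \<and> (\<forall>K\<in>elements M. \<forall>f\<in>poly_space l.
    integral (rect M K) (\<lambda>z. (g z - w z) * f z) = 0)" for g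
  \<comment> \<open>The element polynomials are glued. On an open element the chosen
    \<open>K\<close> is unique; elsewhere the value is arbitrary and harmless.\<close>
  define g where "g z = G (SOME K. K \<in> elements M \<and> z \<in> interior (rect M K)) z" for z
  have g: "g z = G K z" if "K \<in> elements M" "z \<in> interior (rect M K)" for K z
  proof -
    have "(SOME K. K \<in> elements M \<and> z \<in> interior (rect M K)) = K"
      using that disjoint_interior_rect[OF assms(1)] by (intro some_equality) blast+
    then show ?thesis by (simp add: g_def)
  qed
  have "integral (rect M K) (\<lambda>z. (g z - w z) * f z) = 0"
    if "K \<in> elements M" "f \<in> poly_space l" for K f
    unfolding G(2)[OF that, symmetric] using g[OF that(1)] by (intro integral_rect_cong) simp
  moreover have "g \<in> Vh M l"
    unfolding Vh_def using g G(1) by auto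
  ultimately have "Q g" by (simp add: Q_def)
  then have "Q (SOME g. Q g)" by (rule someI[of Q])
  then show ?thesis by (simp add: Q_def L2_proj_def)
qed

text \<open>With Pw the projection of w, orthogonality of w - Pw to Pw turns the integral of (w -
  Pw) w into that of (w - Pw) squared. Integrability is recorded for adding the two gradient
  components later.\<close>

lemma L2_proj_residual:
  assumes "valid_mesh M" "broken_cont M w" "K \<in> elements M"
  shows "0 \<le> integral (rect M K) (\<lambda>z. (w z - L2_proj M l w z) * w z)"
    and "(\<lambda>z. (w z - L2_proj M l w z) * w z) integrable_on rect M K"
proof -
  note P = L2_proj_works[OF assms(1,2), of l]
  obtain a b where ab: "rect M K = cbox a b" by (rule rect_cbox)
  obtain W where W: "\<And>S. continuous_on S W" "\<And>z. z \<in> interior (rect M K) \<Longrightarrow> w z = W z"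
    using broken_contE[OF assms(2,3)] by blast
  obtain g where g: "g \<in> poly_space l" "C1_fun g"
      "\<And>z. z \<in> interior (rect M K) \<Longrightarrow> L2_proj M l w z = g z"
    using VhE[OF _ assms(3)] P by metis
  have cg: "continuous_on (cbox a b) g" "continuous_on (cbox a b) (\<lambda>z. W z - g z)"
    by (intro continuous_on_diff C1_fun_D W g)+
  have eq: "(w z - L2_proj M l w z) * w z = (W z - g z) * (1 * (W z - g z) + 1 * g z)"
    if "z \<in> interior (rect M K)" for z
    using that g(3) W(2) by simp
  have "0 = integral (rect M K) (\<lambda>z. (L2_proj M l w z - w z) * g z)"
    using P assms(3) g(1) by simp
  also have "\<dots> = integral (rect M K) (\<lambda>z. - ((W z - g z) * g z))"
    using g(3) W(2) by (intro integral_rect_cong) (simp add: algebra_simps)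
  also have "\<dots> = - l2_prod (cbox a b) (\<lambda>z. W z - g z) g"
    by (simp add: l2_prod_def ab)
  finally have 0: "l2_prod (cbox a b) (\<lambda>z. W z - g z) g = 0" by simp
  have "integral (rect M K) (\<lambda>z. (w z - L2_proj M l w z) * w z) =
      l2_prod (cbox a b) (\<lambda>z. W z - g z) (\<lambda>z. 1 * (W z - g z) + 1 * g z)"
    unfolding l2_prod_def ab[symmetric] by (intro integral_rect_cong eq)
  also have "\<dots> = l2_prod (cbox a b) (\<lambda>z. W z - g z) (\<lambda>z. W z - g z)"
    using 0 by (subst l2_prod_lincomb_right) (auto intro: cg)
  finally show "0 \<le> integral (rect M K) (\<lambda>z. (w z - L2_proj M l w z) * w z)"
    using l2_prod_self_nonneg by simp
  have "(\<lambda>z. (W z - g z) * (1 * (W z - g z) + 1 * g z)) integrable_on cbox a b"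
    by (intro integrable_continuous continuous_intros cg)
  then show "(\<lambda>z. (w z - L2_proj M l w z) * w z) integrable_on rect M K"
    unfolding ab using eq by (auto simp: ab intro: integrable_spike_interior[rotated])
qed

section \<open>Traces on the sides of an element\<close>

lemma side_point_in_rect:
  assumes "valid_mesh M" "K \<in> elements M" "r \<in> side_range M K s"
  shows "side_point M K s r \<in> rect M K"
proof -
  obtain i j where K: "K = (i, j)" by (cases K)
  show ?thesis
    using assms(2,3) valid_mesh_D(3)[OF assms(1), of i] valid_mesh_D(4)[OF assms(1), of j]
    unfolding K by (cases s) (auto simp: elements_def)
qed

lemma continuous_on_trace_in:
  assumes "valid_mesh M" "broken_cont M w" "K \<in> elements M"
  shows "continuous_on (side_range M K s) (trace_in M w K s)"
proof -
  obtain W where W: "\<And>S. continuous_on S W" "\<And>z. z \<in> interior (rect M K) \<Longrightarrow> w z = W z"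
    using broken_contE[OF assms(2,3)] by blast
  have "continuous_on (side_range M K s) (side_point M K s)"
    by (cases K; cases s) (auto intro!: continuous_intros)
  then have "continuous_on (side_range M K s) (\<lambda>r. W (side_point M K s r))"
    using W(1) continuous_on_compose2 by blast
  then show ?thesis
    by (rule continuous_on_eq)
       (simp add: trace_in_def elem_trace_eq[OF assms(1,3) _ W] side_point_in_rect[OF assms(1,3)])
qed

section \<open>Pairing the two sides of every edge\<close>

lemma opposite_opposite [simp]: "opposite (opposite s) = s"
  by (cases s) auto

lemma normal_opposite [simp]: "normal (opposite s) = - normal s"
  by (cases s) auto

lemma neighbour_in_elements:
  assumes "K \<in> elements M"
  shows "neighbour M K s \<in> elements M"
  using assms by (cases K; cases s) (auto simp: elements_def)

lemma neighbour_neighbour: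
  assumes "K \<in> elements M"
  shows "neighbour M (neighbour M K s) (opposite s) = K"
  using assms by (cases K; cases s) (auto simp: elements_def)

text \<open>Crossing a side changes only the index transverse to it, while the parameter range
  depends on the other index. The periodic wrap therefore has no effect here.\<close>

lemma side_range_neighbour: "side_range M (neighbour M K s) (opposite s) = side_range M K s"
  by (cases K; cases s) auto

lemma continuous_on_trace_out:
  assumes "valid_mesh M" "broken_cont M w" "K \<in> elements M"
  shows "continuous_on (side_range M K s) (trace_out M w K s)"
  using continuous_on_trace_in[OF assms(1,2) neighbour_in_elements[OF assms(3)], of s "opposite s"]
  by (simp add: side_range_neighbour trace_out_def[abs_def])

lemma side_range_integrable:
  fixes f :: "real \<Rightarrow> real"
  assumes "continuous_on (side_range M K s) f"
  shows "f integrable_on side_range M K s"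
  using assms by (cases K; cases s) (auto intro: integrable_continuous_real)

text \<open>A sign is available only for the two contributions of an edge together, so they are
  brought under one integral before estimating.\<close>

lemma sum_boundary_integral_nonpos:
  assumes int: "\<And>K s. K \<in> elements M \<Longrightarrow> F K s integrable_on side_range M K s"
    and pair: "\<And>K s r. K \<in> elements M \<Longrightarrow> r \<in> side_range M K s \<Longrightarrow>
      F K s r + F (neighbour M K s) (opposite s) r \<le> 0"
  shows "(\<Sum>K\<in>elements M. boundary_integral M K (F K)) \<le> 0"
proof -
  let ?A = "elements M \<times> {West, East, South, North}"
  define N where "N = (\<lambda>(K, s). (neighbour M K s, opposite s))"
  define J where "J = (\<lambda>(K, s). integral (side_range M K s) (F K s))"
  have all: "s \<in> {West, East, South, North}" for s by (cases s) auto
  have N: "N x \<in> ?A" "N (N x) = x" if "x \<in> ?A" for x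
  proof -
    obtain K s where x1: "x = (K, s)" by (cases x)
    then have x: "x = (K, s)" "K \<in> elements M" using that by simp_all
    show "N x \<in> ?A" unfolding N_def x(1) split_conv
      using all neighbour_in_elements[OF x(2)] by (intro SigmaI)
    show "N (N x) = x" unfolding N_def x(1) split_conv neighbour_neighbour[OF x(2)] by simp
  qed
  have "sum J ?A = sum (J \<circ> N) ?A"
    using N by (intro sum.reindex_bij_witness[of _ N N]) auto
  \<comment> \<open>\<open>N\<close> exchanges the two sides of an edge. It may fix the element (when \<open>nx M = 1\<close> or
    \<open>ny M = 1\<close>) but never the side, so summing twice avoids choosing one side per edge.\<close>
  then have "2 * sum J ?A = (\<Sum>x\<in>?A. J x + J (N x))"
    by (simp add: sum.distrib)
  also have "\<dots> \<le> 0"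
  proof (rule sum_nonpos)
    fix x assume x: "x \<in> ?A"
    obtain K s where K: "x = (K, s)" "K \<in> elements M" using x by auto
    note i = int[OF K(2), of s] int[OF neighbour_in_elements[OF K(2)], of s "opposite s"]
    have "J x + J (N x) =
        integral (side_range M K s) (\<lambda>r. F K s r + F (neighbour M K s) (opposite s) r)"
      using i by (simp add: J_def N_def K side_range_neighbour integral_add)
    also have "\<dots> \<le> integral (side_range M K s) (\<lambda>r. 0)"
      using i by (intro integral_le integrable_add integrable_0 pair[OF K(2)]) (simp_all add: side_range_neighbour)
    also have "\<dots> = 0" by simp
    finally show "J x + J (N x) \<le> 0" .
  qed
  finally have "sum J ?A \<le> 0" by simp
  then show ?thesis
    unfolding boundary_integral_def J_def sum.cartesian_product .
qed

text \<open>All boundary integrands of the two equations, tested with \<open>u\<close> and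
  \<open>v\<close> respectively and added; \<open>\<kappa>\<close> stands for
  \<open>c / h\<^sup>2\<close>.\<close>

definition edge_flux ::
  "mesh \<Rightarrow> real \<Rightarrow> real \<Rightarrow> real \<Rightarrow> real \<Rightarrow> (real \<times> real \<Rightarrow> real) \<Rightarrow> (real \<times> real \<Rightarrow> real) \<Rightarrow>
   nat \<times> nat \<Rightarrow> side \<Rightarrow> real \<Rightarrow> real" where
  "edge_flux M \<alpha> \<tau> \<beta> \<kappa> u v K s r =
     (flux_v M \<alpha> \<tau> u v K s r - trace_in M v K s r) * (trace_in M (grad u) K s r \<bullet> normal s)
     - \<kappa> * ((jump M u K s r \<bullet> normal s) * trace_in M u K s r)
     + (flux_grad M \<alpha> \<beta> u v K s r \<bullet> normal s) * trace_in M v K s r"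

text \<open>Crossing the edge exchanges the traces and reverses the normal, while both fluxes keep
  their values. With {.} the average and [.] the jump, the identity {v} [\<nabla>u] + {\<nabla>u} .
  [v] = [v \<nabla>u] cancels the central parts against the subtracted interior traces of
  \<open>v\<close>. The \<open>zeta\<close> parts of the two fluxes cancel each other, and only the
  penalties remain.\<close>

lemma edge_flux_pair:
  assumes "K \<in> elements M"
  shows "edge_flux M \<alpha> \<tau> \<beta> \<kappa> u v K s r + edge_flux M \<alpha> \<tau> \<beta> \<kappa> u v (neighbour M K s) (opposite s) r =
    - (\<tau> * (grad_jump M u K s r)\<^sup>2 + \<beta> * (trace_in M v K s r - trace_out M v K s r)\<^sup>2
       + \<kappa> * (trace_in M u K s r - trace_out M u K s r)\<^sup>2)"
proof -
  have out: "trace_out M w (neighbour M K s) (opposite s) r = trace_in M w K s r"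
    "trace_in M w (neighbour M K s) (opposite s) r = trace_out M w K s r"
    for w :: "real \<times> real \<Rightarrow> 'a::t2_space"
    by (simp_all add: trace_out_def neighbour_neighbour[OF assms])
  have n: "normal s \<bullet> normal s = 1" by (cases s) auto
  show ?thesis
    unfolding edge_flux_def flux_v_def flux_grad_def jump_def grad_jump_def out normal_opposite
    by (simp add: inner_add_left inner_add_right inner_diff_left inner_diff_right n power2_eq_square field_simps)
qed

lemma edge_flux_continuous:
  assumes "valid_mesh M" "u \<in> Vh M p" "v \<in> Vh M q" "K \<in> elements M"
  shows "continuous_on (side_range M K s)
      (\<lambda>r. (flux_v M \<alpha> \<tau> u v K s r - trace_in M v K s r) * (trace_in M (grad u) K s r \<bullet> normal s))"
    and "continuous_on (side_range M K s) (\<lambda>r. (jump M u K s r \<bullet> normal s) * trace_in M u K s r)"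
    and "continuous_on (side_range M K s) (\<lambda>r. (flux_grad M \<alpha> \<beta> u v K s r \<bullet> normal s) * trace_in M v K s r)"
  unfolding flux_v_def flux_grad_def jump_def grad_jump_def
  by (intro continuous_intros continuous_on_trace_in continuous_on_trace_out assms
      Vh_broken_cont(1)[OF assms(2)] Vh_broken_cont(1)[OF assms(3)] Vh_broken_cont(4)[OF assms(2)]; simp)+

lemma boundary_integral_edge_flux:
  assumes "valid_mesh M" "u \<in> Vh M p" "v \<in> Vh M q" "K \<in> elements M"
  shows "boundary_integral M K (edge_flux M \<alpha> \<tau> \<beta> \<kappa> u v K) =
      boundary_integral M K (\<lambda>s r. (flux_v M \<alpha> \<tau> u v K s r - trace_in M v K s r)
                                     * (trace_in M (grad u) K s r \<bullet> normal s))
      - \<kappa> * boundary_integral M K (\<lambda>s r. (jump M u K s r \<bullet> normal s) * trace_in M u K s r)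
      + boundary_integral M K (\<lambda>s r. (flux_grad M \<alpha> \<beta> u v K s r \<bullet> normal s) * trace_in M v K s r)"
proof -
  note i = edge_flux_continuous[OF assms, THEN side_range_integrable]
  have "integral (side_range M K s) (edge_flux M \<alpha> \<tau> \<beta> \<kappa> u v K s) =
      integral (side_range M K s) (\<lambda>r. (flux_v M \<alpha> \<tau> u v K s r - trace_in M v K s r)
                                     * (trace_in M (grad u) K s r \<bullet> normal s))
      - \<kappa> * integral (side_range M K s) (\<lambda>r. (jump M u K s r \<bullet> normal s) * trace_in M u K s r)
      + integral (side_range M K s) (\<lambda>r. (flux_grad M \<alpha> \<beta> u v K s r \<bullet> normal s) * trace_in M v K s r)"
    for s
  proof -
    have i2: "(\<lambda>r. \<kappa> * ((jump M u K s r \<bullet> normal s) * trace_in M u K s r)) integrable_on side_range M K s"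
      by (intro side_range_integrable continuous_on_mult_left edge_flux_continuous[OF assms])
    show ?thesis
      unfolding edge_flux_def[abs_def] integral_add[OF integrable_diff[OF i(1) i2] i(3)]
        integral_diff[OF i(1) i2] integral_mult_right ..
  qed
  then show ?thesis
    by (simp only: boundary_integral_def sum.distrib sum_subtractf sum_distrib_left)
qed

lemma sum_edge_flux_nonpos:
  assumes "valid_mesh M" "u \<in> Vh M p" "v \<in> Vh M q" "0 \<le> \<tau>" "0 \<le> \<beta>" "0 \<le> \<kappa>"
  shows "(\<Sum>K\<in>elements M. boundary_integral M K (edge_flux M \<alpha> \<tau> \<beta> \<kappa> u v K)) \<le> 0"
proof (rule sum_boundary_integral_nonpos)
  fix K s assume "K \<in> elements M"
  then show "edge_flux M \<alpha> \<tau> \<beta> \<kappa> u v K s integrable_on side_range M K s"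
    unfolding edge_flux_def[abs_def]
    by (intro side_range_integrable continuous_on_add continuous_on_diff continuous_on_mult_left
        edge_flux_continuous[OF assms(1-3)])
next
  fix K s r assume "K \<in> elements M"
  then show "edge_flux M \<alpha> \<tau> \<beta> \<kappa> u v K s r +
      edge_flux M \<alpha> \<tau> \<beta> \<kappa> u v (neighbour M K s) (opposite s) r \<le> 0"
    unfolding edge_flux_pair[OF \<open>K \<in> elements M\<close>] neg_le_0_iff_le
    using assms(4-6) by (intro add_nonneg_nonneg mult_nonneg_nonneg zero_le_power2)
qed

section \<open>Time derivatives\<close>

lemma integrable_rect_cong:
  fixes f :: "real \<times> real \<Rightarrow> real"
  assumes "\<And>z. z \<in> interior (rect M K) \<Longrightarrow> f z = g z" "continuous_on (rect M K) g"
  shows "f integrable_on rect M K"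
proof -
  obtain a b where ab: "rect M K = cbox a b" by (rule rect_cbox)
  show ?thesis
    using assms(1) integrable_rect[OF assms(2)] integrable_spike_interior[of a b f g]
    unfolding ab interior_cbox by simp
qed

text \<open>The nodes \<open>Z\<close> and the polynomials \<open>L z\<close> do not depend on time,
  so all time dependence sits in finitely many point values. Differentiating the finite sum shows
  that the time derivative has the same expansion.\<close>

lemma time_interpolation:
  assumes w: "\<forall>s\<in>{0<..T}. w s \<in> Vh M k"
    and diff: "time_differentiable M T w" and t: "t \<in> {0<..T}" and K: "K \<in> elements M"
  shows "\<exists>Z L. (\<forall>z\<in>Z. L z \<in> poly_space k) \<and>
    (\<forall>s\<in>{0<..T}. \<forall>x\<in>interior (rect M K). w s x = (\<Sum>z\<in>Z. w s z * L z x)) \<and>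
    (\<forall>z\<in>Z. ((\<lambda>s. w s z) has_real_derivative time_deriv T w t z) (at t within {0<..T})) \<and>
    (\<forall>x\<in>interior (rect M K). time_deriv T w t x = (\<Sum>z\<in>Z. time_deriv T w t z * L z x))"
proof -
  let ?F = "at t within {0<..T}"
  obtain Z L where *: "Z \<subseteq> interior (rect M K)"
    "\<forall>z\<in>Z. L z \<in> poly_space k"
    "\<forall>f\<in>poly_space k. \<forall>x\<in>interior (rect M K). f x = (\<Sum>z\<in>Z. f z * L z x)"
    using fspan_dual_basis[OF finite_degree_le[of k], of "interior (rect M K)" monom2]
    unfolding poly_space_eq_fspan[symmetric] by (elim exE conjE) (rule that)
  note Z = *(1) and L = *(2) and rep = *(3)[rule_format]
  have w_rep: "w s x = (\<Sum>z\<in>Z. w s z * L z x)" if s: "s \<in> {0<..T}" and x: "x \<in> interior (rect M K)" for s x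
  proof -
    obtain W where W: "W \<in> poly_space k" "\<And>z. z \<in> interior (rect M K) \<Longrightarrow> w s z = W z"
      by (rule VhE[OF w[rule_format, OF s] K]) (rule that; assumption)
    have "(\<Sum>z\<in>Z. w s z * L z x) = (\<Sum>z\<in>Z. W z * L z x)"
      using W(2) Z by (intro sum.cong) auto
    then show ?thesis using rep[OF W(1) x] W(2)[OF x] by simp
  qed
  have deriv: "((\<lambda>s. w s x) has_vector_derivative time_deriv T w t x) ?F"
    if "x \<in> interior (rect M K)" for x
    using diff t K that unfolding time_differentiable_def time_deriv_def
    by (simp add: vector_derivative_works[symmetric])
  \<comment> \<open>Uniqueness of the one-sided derivative needs a nontrivial filter. Times below
    \<open>t\<close> always lie in the interval, also for \<open>t = T\<close>.\<close>
  have nt: "?F \<noteq> bot"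
  proof -
    have "t islimpt {0<..<t}" using t by (intro islimpt_greaterThanLessThan2) simp
    then have "t islimpt {0<..T}" using t by (elim islimpt_subset) auto
    then show ?thesis by (simp add: trivial_limit_within)
  qed
  have t_rep: "time_deriv T w t x = (\<Sum>z\<in>Z. time_deriv T w t z * L z x)"
    if x: "x \<in> interior (rect M K)" for x
  proof -
    have "((\<lambda>s. \<Sum>z\<in>Z. w s z * L z x) has_vector_derivative (\<Sum>z\<in>Z. time_deriv T w t z * L z x)) ?F"
      using Z deriv
      by (intro has_vector_derivative_sum has_vector_derivative_mult_left) auto
    then have "((\<lambda>s. w s x) has_vector_derivative (\<Sum>z\<in>Z. time_deriv T w t z * L z x)) ?F"
      by (rule has_vector_derivative_transform[OF t, rotated]) (simp add: w_rep x)
    then show ?thesis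
      by (rule vector_derivative_unique_within[OF nt deriv[OF x]])
  qed
  show ?thesis
  proof (intro exI conjI ballI)
    show "((\<lambda>s. w s z) has_real_derivative time_deriv T w t z) ?F" if "z \<in> Z" for z
      using deriv[of z] that Z by (auto simp: has_real_derivative_iff_has_vector_derivative)
  qed (use L w_rep t_rep in auto)
qed

lemma time_deriv_Vh:
  assumes "\<forall>s\<in>{0<..T}. w s \<in> Vh M k" "time_differentiable M T w" "t \<in> {0<..T}"
  shows "time_deriv T w t \<in> Vh M k"
  unfolding Vh_def
proof (intro CollectI ballI)
  fix K assume K: "K \<in> elements M"
  obtain Z L where L: "\<forall>z\<in>Z. L z \<in> poly_space k"
    and r: "\<forall>x\<in>interior (rect M K). time_deriv T w t x = (\<Sum>z\<in>Z. time_deriv T w t z * L z x)"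
    using time_interpolation[OF assms K] by (elim exE conjE) (rule that)
  show "\<exists>f\<in>poly_space k. \<forall>z\<in>interior (rect M K). time_deriv T w t z = f z"
  proof (intro bexI ballI)
    show "(\<lambda>x. \<Sum>z\<in>Z. time_deriv T w t z * L z x) \<in> poly_space k"
      using L unfolding poly_space_eq_fspan by (intro fspan_sum) simp
  qed (use r in simp)
qed

text \<open>The square is a quadratic form in the coefficients with the constant Gram matrix
  \<open>G\<close>. Symmetry of the product makes the two terms of the product rule equal, hence the
  factor 2.\<close>

lemma l2_prod_square_derivative:
  assumes F: "\<And>z. z \<in> Z \<Longrightarrow> continuous_on (cbox a b) (F z)"
    and c: "\<And>z. z \<in> Z \<Longrightarrow> (c z has_real_derivative c' z) (at t within S)"
  shows "((\<lambda>s. l2_prod (cbox a b) (\<lambda>x. \<Sum>z\<in>Z. c z s * F z x) (\<lambda>x. \<Sum>z\<in>Z. c z s * F z x))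
    has_real_derivative
      2 * l2_prod (cbox a b) (\<lambda>x. \<Sum>z\<in>Z. c' z * F z x) (\<lambda>x. \<Sum>z\<in>Z. c z t * F z x)) (at t within S)"
proof -
  define G where "G z y = l2_prod (cbox a b) (F z) (F y)" for z y
  have cont: "continuous_on (cbox a b) (\<lambda>x. \<Sum>z\<in>Z. d z * F z x)" for d
    by (intro continuous_intros F)
  have expand: "l2_prod (cbox a b) (\<lambda>x. \<Sum>z\<in>Z. d z * F z x) (\<lambda>x. \<Sum>z\<in>Z. e z * F z x) =
      (\<Sum>z\<in>Z. d z * (\<Sum>y\<in>Z. e y * G z y))" for d e
  proof -
    have "l2_prod (cbox a b) (F z) (\<lambda>x. \<Sum>y\<in>Z. e y * F y x) = (\<Sum>y\<in>Z. e y * G z y)" if "z \<in> Z" for z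
      using l2_prod_sum[of Z a b F "F z" e] F that by (simp add: l2_prod_commute G_def)
    then show ?thesis
      using l2_prod_sum[of Z a b F _ d, OF F cont] by simp
  qed
  have "((\<lambda>s. \<Sum>z\<in>Z. c z s * (\<Sum>y\<in>Z. c y s * G z y)) has_real_derivative
      (\<Sum>z\<in>Z. c z t * (\<Sum>y\<in>Z. c' y * G z y) + c' z * (\<Sum>y\<in>Z. c y t * G z y))) (at t within S)"
    by (intro DERIV_sum DERIV_mult' DERIV_cmult_right c)
  moreover have "(\<Sum>z\<in>Z. c z t * (\<Sum>y\<in>Z. c' y * G z y)) = (\<Sum>z\<in>Z. c' z * (\<Sum>y\<in>Z. c y t * G z y))"
    unfolding expand[symmetric] by (rule l2_prod_commute)
  ultimately show ?thesis
    unfolding expand by (simp add: sum.distrib)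
qed

text \<open>Both gradient components and \<open>v\<close> are combinations of fixed functions with
  point values as coefficients, so the square rule applies three times. The finite sums also make
  the spatial gradient commute with the time derivative.\<close>

lemma element_energy_derivative:
  assumes u: "\<forall>s\<in>{0<..T}. u s \<in> Vh M p" and ut: "time_differentiable M T u"
    and v: "\<forall>s\<in>{0<..T}. v s \<in> Vh M q" and vt: "time_differentiable M T v"
    and t: "t \<in> {0<..T}" and K: "K \<in> elements M"
  shows "((\<lambda>s. integral (rect M K) (\<lambda>z. grad (u s) z \<bullet> grad (u s) z + (v s z)\<^sup>2)) has_real_derivative
      2 * integral (rect M K) (\<lambda>z. grad (time_deriv T u t) z \<bullet> grad (u t) z + time_deriv T v t z * v t z))
      (at t within {0<..T})"
proof -
  let ?I = "interior (rect M K)"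
  let ?u' = "time_deriv T u t" and ?v' = "time_deriv T v t"
  obtain a b where ab: "rect M K = cbox a b" by (rule rect_cbox)
  obtain Z L where *: "\<forall>z\<in>Z. L z \<in> poly_space p"
    "\<forall>s\<in>{0<..T}. \<forall>x\<in>?I. u s x = (\<Sum>z\<in>Z. u s z * L z x)"
    "\<forall>z\<in>Z. ((\<lambda>s. u s z) has_real_derivative ?u' z) (at t within {0<..T})"
    "\<forall>x\<in>?I. ?u' x = (\<Sum>z\<in>Z. ?u' z * L z x)"
    using time_interpolation[OF u ut t K] by (elim exE conjE) (rule that)
  note L = *(1)[rule_format] and ur = *(2)[rule_format] and ud = *(3)[rule_format]
    and utr = *(4)[rule_format]
  obtain Y N where *: "\<forall>z\<in>Y. N z \<in> poly_space q"
    "\<forall>s\<in>{0<..T}. \<forall>x\<in>?I. v s x = (\<Sum>z\<in>Y. v s z * N z x)"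
    "\<forall>z\<in>Y. ((\<lambda>s. v s z) has_real_derivative ?v' z) (at t within {0<..T})"
    "\<forall>x\<in>?I. ?v' x = (\<Sum>z\<in>Y. ?v' z * N z x)"
    using time_interpolation[OF v vt t K] by (elim exE conjE) (rule that)
  note N = *(1)[rule_format] and vr = *(2)[rule_format] and vd = *(3)[rule_format]
    and vtr = *(4)[rule_format]
  note LC = C1_fun_poly[OF L] and NC = C1_fun_poly[OF N]
  define U where "U d x = (\<Sum>z\<in>Z. d z * dx (L z) x)" for d x
  define W where "W d x = (\<Sum>z\<in>Z. d z * dy (L z) x)" for d x
  define V where "V d x = (\<Sum>z\<in>Y. d z * N z x)" for d x
  have cont: "continuous_on S (U d)" "continuous_on S (W d)" "continuous_on S (V d)" for S d
    unfolding U_def[abs_def] W_def[abs_def] V_def[abs_def]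
    by (intro continuous_on_sum continuous_on_mult_left C1_fun_D LC NC; assumption)+
  have gr: "grad f x = (U d x, W d x)"
    if "x \<in> ?I" "\<And>x. x \<in> ?I \<Longrightarrow> f x = (\<Sum>z\<in>Z. d z * L z x)" for f d x
    using dx_dy_cong(3)[OF open_interior that(1), of f, OF that(2)]
    by (simp add: grad_def C1_fun_sum[OF LC] U_def W_def)
  have split: "integral (rect M K) (\<lambda>x. U d x * U e x + W d x * W e x + V d' x * V e' x) =
      l2_prod (cbox a b) (U d) (U e) + l2_prod (cbox a b) (W d) (W e) + l2_prod (cbox a b) (V d') (V e')"
    for d e d' e'
    unfolding l2_prod_def ab
    by (subst integral_add integral_add; (intro integrable_continuous continuous_intros cont)?)+ simp
  have 1: "integral (rect M K) (\<lambda>z. grad (u s) z \<bullet> grad (u s) z + (v s z)\<^sup>2) =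
      l2_prod (cbox a b) (U (u s)) (U (u s)) + l2_prod (cbox a b) (W (u s)) (W (u s)) +
      l2_prod (cbox a b) (V (v s)) (V (v s))" if s: "s \<in> {0<..T}" for s
    unfolding split[symmetric]
    using gr[OF _ ur[OF s]] vr[OF s]
    by (intro integral_rect_cong) (simp add: V_def power2_eq_square)
  have 2: "integral (rect M K) (\<lambda>z. grad ?u' z \<bullet> grad (u t) z + ?v' z * v t z) =
      l2_prod (cbox a b) (U ?u') (U (u t)) + l2_prod (cbox a b) (W ?u') (W (u t)) +
      l2_prod (cbox a b) (V ?v') (V (v t))"
    unfolding split[symmetric]
    using gr[OF _ ur[OF t]] vr[OF t] gr[OF _ utr] vtr
    by (intro integral_rect_cong) (simp add: V_def)
  have "((\<lambda>s. l2_prod (cbox a b) (U (u s)) (U (u s)) + l2_prod (cbox a b) (W (u s)) (W (u s)) +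
      l2_prod (cbox a b) (V (v s)) (V (v s))) has_real_derivative
      2 * l2_prod (cbox a b) (U ?u') (U (u t)) + 2 * l2_prod (cbox a b) (W ?u') (W (u t)) +
      2 * l2_prod (cbox a b) (V ?v') (V (v t))) (at t within {0<..T})"
    unfolding U_def W_def V_def
    by (intro DERIV_add l2_prod_square_derivative ud vd C1_fun_D LC NC; assumption)
  then show ?thesis
    unfolding 2 distrib_left
    \<comment> \<open>The radius 1 is arbitrary: the two functions agree on the whole time
      interval.\<close>
    by (rule has_field_derivative_transform_within[OF _ zero_less_one t]) (simp add: 1)
qed

section \<open>Energy balance on an element\<close>

lemma diam_nonneg: "0 \<le> diam M K"
  by (cases K) simp

lemma vertex_jumps_nonneg: "0 \<le> vertex_jumps M l w K"
  unfolding vertex_jumps_def vertex_jump_sq_def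
  by (intro sum_nonneg) (auto intro!: add_nonneg_nonneg)

text \<open>The denominator \<open>2 * real p - 1\<close> is positive because
  \<open>1 \<le> p\<close>, and the vector projection acts componentwise, so the scalar residual
  estimate applies to \<open>dx u\<close> and \<open>dy u\<close> separately.\<close>

lemma damping_u_nonneg:
  assumes "valid_mesh M" "u \<in> Vh M p" "K \<in> elements M" "1 \<le> p"
  shows "0 \<le> (\<Sum>l=1..p. sigma_u M p u K l / diam M K *
      integral (rect M K) (\<lambda>z. (grad u z - L2_proj_vec M (l - 1) (grad u) z) \<bullet> grad u z))"
proof (intro sum_nonneg mult_nonneg_nonneg)
  fix l
  show "0 \<le> sigma_u M p u K l / diam M K"
    unfolding sigma_u_def using assms(4)
    by (intro divide_nonneg_nonneg mult_nonneg_nonneg vertex_jumps_nonneg diam_nonneg zero_le_power) auto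
  note res = L2_proj_residual[OF assms(1) Vh_broken_cont(2)[OF assms(2)] assms(3), of "l - 1"]
    L2_proj_residual[OF assms(1) Vh_broken_cont(3)[OF assms(2)] assms(3), of "l - 1"]
  have "(\<lambda>z. (grad u z - L2_proj_vec M (l - 1) (grad u) z) \<bullet> grad u z) =
      (\<lambda>z. (dx u z - L2_proj M (l - 1) (dx u) z) * dx u z + (dy u z - L2_proj M (l - 1) (dy u) z) * dy u z)"
    by (simp add: L2_proj_vec_def grad_def)
  then show "0 \<le> integral (rect M K) (\<lambda>z. (grad u z - L2_proj_vec M (l - 1) (grad u) z) \<bullet> grad u z)"
    using res by (simp only: integral_add add_nonneg_nonneg)
qed

lemma damping_v_nonneg:
  assumes "valid_mesh M" "v \<in> Vh M q" "K \<in> elements M" "1 \<le> q"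
  shows "0 \<le> (\<Sum>l=0..q. sigma_v M q v K l / diam M K *
      integral (rect M K) (\<lambda>z. (v z - L2_proj M (l - 1) v z) * v z))"
proof (intro sum_nonneg mult_nonneg_nonneg)
  fix l
  show "0 \<le> sigma_v M q v K l / diam M K"
    unfolding sigma_v_def using assms(4)
    by (intro divide_nonneg_nonneg mult_nonneg_nonneg vertex_jumps_nonneg diam_nonneg zero_le_power) auto
  show "0 \<le> integral (rect M K) (\<lambda>z. (v z - L2_proj M (l - 1) v z) * v z)"
    by (rule L2_proj_residual(1)[OF assms(1) Vh_broken_cont(1)[OF assms(2)] assms(3)])
qed

text \<open>Adding the two tested equations cancels the mixed volume terms, \<nabla>v . \<nabla>u
  from the first against \<nabla>u . \<nabla>v from the second. Dropping the nonnegative damping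
  sums leaves the boundary terms.\<close>

lemma element_energy_balance:
  assumes "valid_mesh M" "1 \<le> p" "1 \<le> q" "K \<in> elements M"
    and u: "u \<in> Vh M p" and v: "v \<in> Vh M q" and ut: "ut \<in> Vh M p" and vt: "vt \<in> Vh M q"
    and ueq: "u_equation M p \<alpha> c \<tau> ut u v K u" and veq: "v_equation M q \<alpha> \<beta> vt u v K v"
  shows "integral (rect M K) (\<lambda>z. grad ut z \<bullet> grad u z + vt z * v z)
    \<le> boundary_integral M K (edge_flux M \<alpha> \<tau> \<beta> (c / (mesh_size M)\<^sup>2) u v K)"
proof -
  let ?I = "interior (rect M K)"
  obtain U where U: "C1_fun U" "\<And>z. z \<in> ?I \<Longrightarrow> grad u z = grad U z"
    by (rule VhE[OF u assms(4)]) (rule that; assumption)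
  obtain V where V: "C1_fun V" "\<And>z. z \<in> ?I \<Longrightarrow> v z = V z" "\<And>z. z \<in> ?I \<Longrightarrow> grad v z = grad V z"
    by (rule VhE[OF v assms(4)]) (rule that; assumption)
  obtain U' where U': "C1_fun U'" "\<And>z. z \<in> ?I \<Longrightarrow> ut z = U' z" "\<And>z. z \<in> ?I \<Longrightarrow> grad ut z = grad U' z"
    by (rule VhE[OF ut assms(4)]) (rule that; assumption)
  obtain V' where V': "C1_fun V'" "\<And>z. z \<in> ?I \<Longrightarrow> vt z = V' z"
    by (rule VhE[OF vt assms(4)]) (rule that; assumption)
  \<comment> \<open>Linearity of the pointwise gradient needs differentiability, so it is applied to
    the polynomials that represent \<open>ut\<close> and \<open>v\<close> on the open
    element.\<close>
  have gd: "grad (\<lambda>y. ut y - v y) z = grad U' z - grad V z" if "z \<in> ?I" for z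
  proof -
    have "grad (\<lambda>y. ut y - v y) z = grad (\<lambda>y. U' y - V y) z"
      by (rule dx_dy_cong(3)[OF open_interior that]) (simp add: U' V)
    then show ?thesis by (simp add: grad_def C1_fun_diff[OF U'(1) V(1)])
  qed
  have i1: "(\<lambda>z. grad (\<lambda>y. ut y - v y) z \<bullet> grad u z) integrable_on rect M K"
    by (rule integrable_rect_cong[of _ _ _ "\<lambda>z. (grad U' z - grad V z) \<bullet> grad U z"])
       (auto simp: gd U intro!: continuous_intros continuous_on_grad U V U')
  have i2: "(\<lambda>z. vt z * v z + grad u z \<bullet> grad v z) integrable_on rect M K"
    by (rule integrable_rect_cong[of _ _ _ "\<lambda>z. V' z * V z + grad U z \<bullet> grad V z"])
       (auto simp: U V V' intro!: continuous_intros continuous_on_grad C1_fun_D(5)[OF V(1)] C1_fun_D(5)[OF V'(1)] U(1) V(1))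
  have "integral (rect M K) (\<lambda>z. grad ut z \<bullet> grad u z + vt z * v z) =
      integral (rect M K) (\<lambda>z. grad (\<lambda>y. ut y - v y) z \<bullet> grad u z + (vt z * v z + grad u z \<bullet> grad v z))"
    by (intro integral_rect_cong)
       (simp add: gd U V U' V' inner_diff_left inner_commute[of "grad U _" "grad V _"])
  also have "\<dots> = integral (rect M K) (\<lambda>z. grad (\<lambda>y. ut y - v y) z \<bullet> grad u z) +
      integral (rect M K) (\<lambda>z. vt z * v z + grad u z \<bullet> grad v z)"
    by (rule integral_add[OF i1 i2])
  also have "\<dots> \<le> boundary_integral M K (edge_flux M \<alpha> \<tau> \<beta> (c / (mesh_size M)\<^sup>2) u v K)"
    using damping_u_nonneg[OF assms(1) u assms(4,2)] damping_v_nonneg[OF assms(1) v assms(4,3)]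
    unfolding ueq[unfolded u_equation_def] veq[unfolded v_equation_def]
      boundary_integral_edge_flux[OF assms(1) u v assms(4)]
    by linarith
  finally show ?thesis .
qed

section \<open>Summation over the mesh and the energy inequality\<close>

lemma energy_eq_sum:
  assumes "valid_mesh M" "u \<in> Vh M p" "v \<in> Vh M q"
  shows "energy M u v = (\<Sum>K\<in>elements M. integral (rect M K) (\<lambda>z. grad u z \<bullet> grad u z + (v z)\<^sup>2))"
  unfolding energy_def
proof (rule integral_domain_rect[OF assms(1)])
  fix K assume K: "K \<in> elements M"
  obtain U where U: "C1_fun U" "\<And>z. z \<in> interior (rect M K) \<Longrightarrow> grad u z = grad U z"
    by (rule VhE[OF assms(2) K]) (rule that; assumption)
  obtain V where V: "C1_fun V" "\<And>z. z \<in> interior (rect M K) \<Longrightarrow> v z = V z"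
    by (rule VhE[OF assms(3) K]) (rule that; assumption)
  show "(\<lambda>z. grad u z \<bullet> grad u z + (v z)\<^sup>2) integrable_on rect M K"
    by (rule integrable_rect_cong[of _ _ _ "\<lambda>z. grad U z \<bullet> grad U z + (V z)\<^sup>2"])
       (auto simp: U V intro!: continuous_intros continuous_on_grad C1_fun_D(5)[OF V(1)] U(1))
qed

theorem theorem3p1:
  fixes M :: mesh and T :: real and p q :: nat and \<alpha> c \<tau> \<beta> :: real
    and u v :: "real \<Rightarrow> real \<times> real \<Rightarrow> real"
  assumes "valid_mesh M" and "0 < T"
    and "1 \<le> p" and "1 \<le> q"
    and "0 \<le> \<alpha>" and "\<alpha> \<le> 1"
    and "0 \<le> c" and "0 \<le> \<tau>" and "0 \<le> \<beta>"
    and "OF_EDG_solution M T p q \<alpha> c \<tau> \<beta> u v"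
  shows "\<forall>t\<in>{0<..T}. \<exists>D. ((\<lambda>s. energy M (u s) (v s)) has_real_derivative D) (at t within {0<..T}) \<and> D \<le> 0"
proof
  fix t assume t: "t \<in> {0<..T}"
  have u: "\<forall>s\<in>{0<..T}. u s \<in> Vh M p" and v: "\<forall>s\<in>{0<..T}. v s \<in> Vh M q"
    and ut: "time_differentiable M T u" and vt: "time_differentiable M T v"
    and ueq: "\<And>K. K \<in> elements M \<Longrightarrow> u_equation M p \<alpha> c \<tau> (time_deriv T u t) (u t) (v t) K (u t)"
    and veq: "\<And>K. K \<in> elements M \<Longrightarrow> v_equation M q \<alpha> \<beta> (time_deriv T v t) (u t) (v t) K (v t)"
    using assms(10) t unfolding OF_EDG_solution_def by auto
  \<comment> \<open>Half the rate of change of the energy on \<open>K\<close>; the factor 2 comes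
    from differentiating squares.\<close>
  define D where "D K = integral (rect M K)
    (\<lambda>z. grad (time_deriv T u t) z \<bullet> grad (u t) z + time_deriv T v t z * v t z)" for K
  have "((\<lambda>s. \<Sum>K\<in>elements M. integral (rect M K) (\<lambda>z. grad (u s) z \<bullet> grad (u s) z + (v s z)\<^sup>2))
      has_real_derivative (\<Sum>K\<in>elements M. 2 * D K)) (at t within {0<..T})"
    unfolding D_def by (intro DERIV_sum element_energy_derivative[OF u ut v vt t])
  then have "((\<lambda>s. energy M (u s) (v s)) has_real_derivative (\<Sum>K\<in>elements M. 2 * D K)) (at t within {0<..T})"
    by (rule has_field_derivative_transform_within[OF _ zero_less_one t])
       (simp add: energy_eq_sum[OF assms(1) u[rule_format] v[rule_format]])
  moreover have "(\<Sum>K\<in>elements M. D K) \<le>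
      (\<Sum>K\<in>elements M. boundary_integral M K (edge_flux M \<alpha> \<tau> \<beta> (c / (mesh_size M)\<^sup>2) (u t) (v t) K))"
    unfolding D_def
    by (intro sum_mono element_energy_balance[OF assms(1,3,4)] u[rule_format] v[rule_format] t ueq veq
        time_deriv_Vh[OF u ut] time_deriv_Vh[OF v vt])
  moreover have "\<dots> \<le> 0"
    using assms by (intro sum_edge_flux_nonpos[OF assms(1) u[rule_format, OF t] v[rule_format, OF t]]) auto
  ultimately show "\<exists>D. ((\<lambda>s. energy M (u s) (v s)) has_real_derivative D) (at t within {0<..T}) \<and> D \<le> 0"
    by (intro exI[of _ "\<Sum>K\<in>elements M. 2 * D K"]) (simp flip: sum_distrib_left)
qed

end
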